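(* Let $N$ be a positive integer, let $S \subset \mathbb{Z}/N\mathbb{Z}$ be a non-empty subset, and let $k$ be a positive integer. Then $$A_{S,N,k}(q) = \Lambda_k\bigl(G_{S,N,2}(q), G_{S,N,4}(q), \dots, G_{S,N,2k}(q)\bigr).$$ In particular, if $S$ is symmetric (i.e. $l \in S$ implies $-l \in S$), then $A_{S,N,k}(q)$ is a (mixed weight) quasi-modular form of level $N$, i.e. $A_{S,N,k}(q) \in \widetilde{\mathcal{M}}(\Gamma_1(N))$.
   Context: For an integer $m$, "$m \in S$" means that the image of $m$ in $\mathbb{Z}/N\mathbb{Z}$ lies in $S$. The generalized MacMahon functions are $$A_{S,N,k}(q) := \sum_{\substack{0 < m_1 < m_2 < \cdots < m_k \\ m_i \in S\ (1 \le i \le k)}} \frac{q^{m_1 + m_2 + \cdots + m_k}}{(1-q^{m_1})^2 (1-q^{m_2})^2 \cdots (1-q^{m_k})^2},$$ and $$G_{S,N,k}(q) := \sum_{n=1}^\infty \Bigl(\sum_{\substack{d \mid n \\ n/d \in S}} d^{k-1} \Bigr)q^n.$$ The polynomials $\Lambda_k(x_2, x_4, \dots, x_{2k}) \in \mathbb{Q}[x_2, x_4, \dots, x_{2k}]$ are defined by the generating series $$1 + \sum_{k=1}^\infty \Lambda_k(x_2, x_4, \dots, x_{2k}) X^{2k} := \exp \left(2 \sum_{j=1}^\infty \frac{(-1)^{j-1}}{(2j)!} \left(2 \arcsin \frac{X}{2}\right)^{2j} x_{2j}\right).$$ $q$-series are regarded as functions of $z$ in the upper half-plane $\mathbb{H}$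 via $q = e^{2\pi i z}$. $\Gamma_1(N)$ is the group of matrices $\begin{pmatrix} a & b \\ c & d\end{pmatrix} \in \mathrm{SL}_2(\mathbb{Z})$ with $c \equiv 0$, $a \equiv d \equiv 1 \pmod N$. $\mathcal{M}_k(\Gamma)$ is the $\mathbb{C}$-vector space of holomorphic modular forms of weight $k$ on $\Gamma$ (holomorphic on $\mathbb{H}$ and at all cusps). The algebra of (mixed weight) quasi-modular forms on $\Gamma$ is $\widetilde{\mathcal{M}}(\Gamma) := \bigl(\bigoplus_{k \in \mathbb{Z}} \mathcal{M}_k(\Gamma)\bigr) \otimes \mathbb{C}[E_2]$, i.e. the functions that are polynomials in $E_2$ with coefficients in $\bigoplus_{k} \mathcal{M}_k(\Gamma)$, where $E_2(z) := 1 - 24\sum_{n=1}^\infty \bigl(\sum_{d \mid n} d\bigr) q^n$. *)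

theory Defs
  imports "HOL-Complex_Analysis.Complex_Analysis" "HOL-Number_Theory.Residues"
begin

subsection \<open>The generalized MacMahon functions and the divisor sums\<close>

text \<open>
  \<open>\<int>/N\<int>\<close> is \<^const>\<open>residue_ring\<close>, whose carrier is the set \<open>{0..N-1}\<close> of least residues.
\<close>

definition residue_in :: "int set \<Rightarrow> nat \<Rightarrow> nat \<Rightarrow> bool" where
  "residue_in S N m \<longleftrightarrow> int m mod int N \<in> S"

definition symmetric_residues :: "int set \<Rightarrow> nat \<Rightarrow> bool" where
  "symmetric_residues S N \<longleftrightarrow> (\<forall>l\<in>S. (- l) mod int N \<in> S)"

text \<open>A tuple \<open>0 < m\<^sub>1 < \<dots> < m\<^sub>k\<close> is encoded by the \<open>k\<close>-element set of its entries.\<close>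

definition macmahon_tuples :: "int set \<Rightarrow> nat \<Rightarrow> nat \<Rightarrow> nat set set" where
  "macmahon_tuples S N k =
     {M. finite M \<and> card M = k \<and> (\<forall>m\<in>M. 0 < m \<and> residue_in S N m)}"

definition macmahon_A :: "int set \<Rightarrow> nat \<Rightarrow> nat \<Rightarrow> complex \<Rightarrow> complex" where
  "macmahon_A S N k q = (\<Sum>\<^sub>\<infinity>M\<in>macmahon_tuples S N k. \<Prod>m\<in>M. q ^ m / (1 - q ^ m)\<^sup>2)"

definition macmahon_G :: "int set \<Rightarrow> nat \<Rightarrow> nat \<Rightarrow> complex \<Rightarrow> complex" where
  "macmahon_G S N k q =
     (\<Sum>\<^sub>\<infinity>n\<in>{1..}. of_nat (\<Sum>d | d dvd n \<and> residue_in S N (n div d). d ^ (k - 1)) * q ^ n)"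

text \<open>Both series converge absolutely for \<open>\<bar>q\<bar> < 1\<close>, so \<^const>\<open>infsum\<close> is their value there.\<close>

lemma macmahon_A_summable:
  fixes q :: complex
  assumes "norm q < 1"
  shows "(\<lambda>M. norm (\<Prod>m\<in>M. q ^ m / (1 - q ^ m)\<^sup>2)) summable_on macmahon_tuples S N k"
proof -
  define a where "a = (\<lambda>m. norm (q ^ m / (1 - q ^ m)\<^sup>2))"
  define C where "C = 1 / (1 - norm q)\<^sup>2"
  have a0: "a m \<ge> 0" for m by (simp add: a_def)
  have C0: "C \<ge> 0" by (simp add: C_def)
  have aC: "a m \<le> C * norm q ^ m" if "m > 0" for m
  proof -
    have "norm q ^ m \<le> norm q"
      using assms that power_decreasing[of 1 m "norm q"] by simp
    then have "1 - norm q \<le> norm (1 - q ^ m)"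
      using norm_triangle_ineq2[of 1 "q ^ m"] by (simp add: norm_power)
    then have "(1 - norm q)\<^sup>2 \<le> (norm (1 - q ^ m))\<^sup>2"
      using assms by (intro power_mono) auto
    then have "norm q ^ m / (norm (1 - q ^ m))\<^sup>2 \<le> norm q ^ m / (1 - norm q)\<^sup>2"
      using assms by (intro divide_left_mono) (auto intro!: mult_pos_pos zero_less_power
          dest: order.strict_trans2[of 0 "(1 - norm q)\<^sup>2"])
    then show ?thesis by (simp add: a_def C_def norm_divide norm_power)
  qed
  define B where "B = exp (C * (1 / (1 - norm q)))"
  have fin: "sum a U \<le> C * (1 / (1 - norm q))" if "finite U" "\<And>m. m \<in> U \<Longrightarrow> m > 0" for U
  proof -
    have "sum a U \<le> (\<Sum>m\<in>U. C * norm q ^ m)"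
      using that by (intro sum_mono aC) auto
    also have "\<dots> = C * (\<Sum>m\<in>U. norm q ^ m)" by (simp add: sum_distrib_left)
    also have "(\<Sum>m\<in>U. norm q ^ m) \<le> (\<Sum>m. norm q ^ m)"
      using assms that by (intro sum_le_suminf summable_geometric) auto
    also have "\<dots> = 1 / (1 - norm q)"
      using assms by (intro suminf_geometric) auto
    finally show ?thesis using C0 by (simp add: mult_left_mono)
  qed
  have bound: "(\<Sum>M\<in>F. \<Prod>m\<in>M. a m) \<le> B"
    if "F \<subseteq> macmahon_tuples S N k" "finite F" for F
  proof -
    define U where "U = \<Union>F"
    have U: "finite U" "\<And>m. m \<in> U \<Longrightarrow> m > 0"
      using that by (auto simp: U_def macmahon_tuples_def)
    have "(\<Sum>M\<in>F. \<Prod>m\<in>M. a m) \<le> (\<Sum>M\<in>Pow U. \<Prod>m\<in>M. a m)"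
      using U that(2) by (intro sum_mono2) (auto simp: U_def intro!: prod_nonneg a0)
    also have "\<dots> = (\<Prod>m\<in>U. a m + 1)"
      using prod_add[OF U(1), of a "\<lambda>_. 1"] by simp
    also have "\<dots> \<le> (\<Prod>m\<in>U. exp (a m))"
      using a0 by (intro prod_mono) (auto simp: add.commute add_nonneg_nonneg)
    also have "\<dots> = exp (sum a U)" using U by (simp add: exp_sum)
    also have "\<dots> \<le> B" using fin[OF U] by (simp add: B_def)
    finally show ?thesis .
  qed
  have "(\<lambda>M. \<Prod>m\<in>M. a m) summable_on macmahon_tuples S N k"
    by (rule nonneg_bdd_above_summable_on)
       (auto intro!: prod_nonneg a0 bdd_aboveI[of _ B] bound)
  then show ?thesis by (simp add: a_def prod_norm)
qed

lemma macmahon_G_summable: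
  fixes q :: complex
  assumes "norm q < 1"
  shows "(\<lambda>n. norm (of_nat (\<Sum>d | d dvd n \<and> residue_in S N (n div d). d ^ (k - 1)) * q ^ n))
           summable_on {1..}"
proof -
  define c where "c = (\<lambda>n. of_nat (\<Sum>d | d dvd n \<and> residue_in S N (n div d). d ^ (k - 1)) :: complex)"
  have pow: "summable (\<lambda>n. real n ^ m * x ^ n)" if "norm x < 1" for m and x :: real
    using that
  proof (induction m arbitrary: x)
    case 0
    then show ?case by (simp add: summable_geometric)
  next
    case (Suc m)
    have "summable (\<lambda>n. diffs (\<lambda>n. real n ^ m) n * x ^ n)"
      by (rule termdiff_converges[of x 1]) (use Suc in auto)
    then have "summable (\<lambda>n. x * (diffs (\<lambda>n. real n ^ m) n * x ^ n))"
      by (rule summable_mult)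
    then have "summable (\<lambda>n. real (Suc n) ^ Suc m * x ^ Suc n)"
      by (simp add: diffs_def mult_ac)
    then show ?case by (subst (asm) summable_Suc_iff)
  qed
  have c: "norm (c n) \<le> real n ^ Suc k" if "n > 0" for n
  proof -
    have "d ^ (k - 1) \<le> n ^ k" if "d dvd n" for d
    proof -
      have "d ^ (k - 1) \<le> n ^ (k - 1)"
        using that \<open>n > 0\<close> by (intro power_mono) (auto dest: dvd_imp_le)
      also have "\<dots> \<le> n ^ k" using \<open>n > 0\<close> by (intro power_increasing) auto
      finally show ?thesis .
    qed
    then have "(\<Sum>d | d dvd n \<and> residue_in S N (n div d). d ^ (k - 1)) \<le>
               (\<Sum>d | d dvd n \<and> residue_in S N (n div d). n ^ k)"
      by (intro sum_mono) auto
    also have "\<dots> \<le> (\<Sum>d\<in>{1..n}. n ^ k)"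
      using \<open>n > 0\<close> by (intro sum_mono2) (auto dest: dvd_imp_le intro!: Nat.gr0I)
    also have "\<dots> = n ^ Suc k" by simp
    finally show ?thesis
      unfolding c_def norm_of_nat of_nat_power[symmetric] of_nat_le_iff .
  qed
  have "summable (\<lambda>n. norm (c (Suc n) * q ^ Suc n))"
  proof (rule summable_comparison_test'[where N = 0])
    show "summable (\<lambda>n. real (Suc n) ^ Suc k * norm q ^ Suc n)"
      using pow[of "norm q" "Suc k"] assms by (subst summable_Suc_iff) auto
    show "norm (norm (c (Suc n) * q ^ Suc n)) \<le> real (Suc n) ^ Suc k * norm q ^ Suc n" for n
      using mult_right_mono[OF c[of "Suc n"], of "norm q ^ Suc n"]
      by (simp add: norm_mult norm_power del: power_Suc of_nat_Suc)
  qed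
  then have "(\<lambda>n. norm (c (Suc n) * q ^ Suc n)) summable_on UNIV"
    by (intro norm_summable_imp_summable_on) auto
  then have "(\<lambda>n. norm (c n * q ^ n)) summable_on (Suc ` UNIV)"
    by (subst summable_on_reindex) (auto simp: o_def)
  moreover have "Suc ` UNIV = {1..}"
    by (auto simp: image_iff Suc_le_eq gr0_conv_Suc)
  ultimately show ?thesis by (simp add: c_def)
qed

subsection \<open>The polynomials \<open>\<Lambda>\<^sub>k\<close>\<close>

definition fps_arcsin :: "'a::field_char_0 fps" where
  "fps_arcsin = fps_inv (fps_sin 1)"

definition two_arcsin_half :: "'a::field_char_0 fps" where
  "two_arcsin_half = fps_const 2 * (fps_arcsin oo (fps_const (1 / 2) * fps_X))"

text \<open>
  The power series \<open>2 \<Sum>\<^bsub>j\<ge>1\<^esub> (-1)\<^bsup>j-1\<^esup> / (2j)! x\<^bsub>2j\<^esub> Y\<^bsup>2j\<^esup>\<close> in \<open>Y\<close>.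
\<close>

definition Lambda_exponent :: "(nat \<Rightarrow> 'a) \<Rightarrow> 'a::field_char_0 fps" where
  "Lambda_exponent x =
     Abs_fps (\<lambda>n. if even n \<and> n > 0 then 2 * ((- 1) ^ (n div 2 - 1) / fact n * x n) else 0)"

text \<open>
  \<open>Lambda_poly k x\<close> is the value of the polynomial \<open>\<Lambda>\<^sub>k\<close> at \<open>x\<^sub>2 = x 2, \<dots>, x\<^bsub>2k\<^esub> = x (2k)\<close>, for
  values in any field of characteristic \<open>0\<close>: the coefficient of \<open>X\<^bsup>2k\<^esup>\<close> in the generating series
  specialized at these values. No other value of \<open>x\<close> enters, see \<open>Lambda_poly_cong\<close>.
\<close>

definition Lambda_poly :: "nat \<Rightarrow> (nat \<Rightarrow> 'a) \<Rightarrow> 'a::field_char_0" where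
  "Lambda_poly k x = fps_nth (fps_exp 1 oo (Lambda_exponent x oo two_arcsin_half)) (2 * k)"

lemma Lambda_poly_cong:
  fixes x y :: "nat \<Rightarrow> 'a::field_char_0"
  assumes "\<And>j. 1 \<le> j \<Longrightarrow> j \<le> k \<Longrightarrow> x (2 * j) = y (2 * j)"
  shows "Lambda_poly k x = Lambda_poly k y"
proof -
  let ?F = "\<lambda>x::nat\<Rightarrow>'a. Lambda_exponent x oo two_arcsin_half"
  have L: "fps_nth (Lambda_exponent x) n = fps_nth (Lambda_exponent y) n" if "n \<le> 2 * k" for n
    using that assms by (auto simp: Lambda_exponent_def elim!: evenE)
  have F: "fps_nth (?F x) n = fps_nth (?F y) n" if "n \<le> 2 * k" for n
    using that by (auto simp: fps_compose_nth L intro!: sum.cong)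
  have P: "fps_nth (?F x ^ i) n = fps_nth (?F y ^ i) n" if "n \<le> 2 * k" for n i
    using that
  proof (induction i arbitrary: n)
    case (Suc i)
    then show ?case by (auto simp: fps_mult_nth F intro!: sum.cong)
  qed simp
  show ?thesis
    unfolding Lambda_poly_def fps_compose_nth[of "fps_exp 1"] by (simp add: P)
qed

subsection \<open>Modular and quasi-modular forms\<close>

definition upper_half_plane :: "complex set" where
  "upper_half_plane = {z. Im z > 0}"

definition nome :: "complex \<Rightarrow> complex" where
  "nome z = exp (2 * of_real pi * \<i> * z)"

definition SL2Z :: "(int ^ 2 ^ 2) set" where
  "SL2Z = {\<gamma>. det \<gamma> = 1}"

definition Gamma1 :: "nat \<Rightarrow> (int ^ 2 ^ 2) set" where
  "Gamma1 N = {\<gamma> \<in> SL2Z. [\<gamma> $ 2 $ 1 = 0] (mod int N) \<and>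
                        [\<gamma> $ 1 $ 1 = 1] (mod int N) \<and> [\<gamma> $ 2 $ 2 = 1] (mod int N)}"

definition slash :: "int \<Rightarrow> int ^ 2 ^ 2 \<Rightarrow> (complex \<Rightarrow> complex) \<Rightarrow> complex \<Rightarrow> complex" where
  "slash k \<gamma> f z =
     (of_int (\<gamma> $ 2 $ 1) * z + of_int (\<gamma> $ 2 $ 2)) powi (- k) *
     f ((of_int (\<gamma> $ 1 $ 1) * z + of_int (\<gamma> $ 1 $ 2)) /
        (of_int (\<gamma> $ 2 $ 1) * z + of_int (\<gamma> $ 2 $ 2)))"

text \<open>
  Holomorphy at \<open>\<infinity>\<close>: a function of the local parameter \<open>exp (2\<pi>iz/h)\<close> that extends
  holomorphically to the value \<open>0\<close> of this parameter.
\<close>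

definition holomorphic_at_infinity :: "(complex \<Rightarrow> complex) \<Rightarrow> bool" where
  "holomorphic_at_infinity f \<longleftrightarrow>
     (\<exists>h::nat. h > 0 \<and> (\<exists>g. g holomorphic_on ball 0 1 \<and>
        (\<forall>z\<in>upper_half_plane. f z = g (nome (z / of_nat h)))))"

text \<open>
  The cusps are the points \<open>\<gamma>\<infinity>\<close> with \<open>\<gamma> \<in> SL\<^sub>2(\<int>)\<close>; holomorphy there is holomorphy of the
  weight \<open>k\<close> transform by \<open>\<gamma>\<close> at \<open>\<infinity>\<close>. As everywhere below, functions on the upper half-plane
  are total functions whose values elsewhere are irrelevant.
\<close>

definition modular_forms :: "int \<Rightarrow> (int ^ 2 ^ 2) set \<Rightarrow> (complex \<Rightarrow> complex) set" where
  "modular_forms k \<Gamma> =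
     {f. f holomorphic_on upper_half_plane \<and>
         (\<forall>\<gamma>\<in>\<Gamma>. \<forall>z\<in>upper_half_plane. slash k \<gamma> f z = f z) \<and>
         (\<forall>\<gamma>\<in>SL2Z. holomorphic_at_infinity (slash k \<gamma> f))}"

definition mixed_modular_forms :: "(int ^ 2 ^ 2) set \<Rightarrow> (complex \<Rightarrow> complex) set" where
  "mixed_modular_forms \<Gamma> =
     {f. \<exists>K g. finite K \<and> (\<forall>k\<in>K. g k \<in> modular_forms k \<Gamma>) \<and>
               (\<forall>z\<in>upper_half_plane. f z = (\<Sum>k\<in>K. g k z))}"

definition Eisenstein_E2 :: "complex \<Rightarrow> complex" where
  "Eisenstein_E2 z = 1 - 24 * (\<Sum>\<^sub>\<infinity>n\<in>{1..}. of_nat (\<Sum>d | d dvd n. d) * nome z ^ n)"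

definition quasimodular_forms :: "(int ^ 2 ^ 2) set \<Rightarrow> (complex \<Rightarrow> complex) set" where
  "quasimodular_forms \<Gamma> =
     {f. \<exists>n c. (\<forall>i\<le>n. c i \<in> mixed_modular_forms \<Gamma>) \<and>
               (\<forall>z\<in>upper_half_plane. f z = (\<Sum>i\<le>(n::nat). c i z * Eisenstein_E2 z ^ i))}"

end

theory Submission
  imports Defs "HOL-Real_Asymp.Real_Asymp"
begin

text \<open>
  Fix \<open>q\<close> with \<open>\<bar>q\<bar> < 1\<close>. Summing \<open>A\<^sub>k X\<^bsup>2k\<^esup>\<close> over \<open>k\<close> gives the product of the factors
  \<open>1 + X\<^sup>2 u / (1 - u)\<^sup>2\<close> over \<open>u = q\<^sup>m\<close>, \<open>m \<in> S\<close>. With \<open>X = 2 sin (\<theta>/2)\<close> such a factor is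
  \<open>(1 - 2 u cos \<theta> + u\<^sup>2) / (1 - u)\<^sup>2\<close>, and its logarithm is \<open>2 \<Sum>\<^sub>d u\<^sup>d (1 - cos d\<theta>) / d\<close>. Expanding the
  cosine and adding over \<open>m\<close> turns the coefficients into the divisor sums \<open>G\<^bsub>2j\<^esub>\<close>, and the change of
  variable \<open>\<theta> = 2 arcsin (X/2)\<close> produces exactly the series that defines \<open>\<Lambda>\<^sub>k\<close>. The factor for one
  \<open>u\<close> is \<open>Lambda_generating_series_polylog\<close>; finite sets of \<open>m\<close> follow because \<open>exp\<close> turns sums into
  products, and \<open>macmahon_A_eq_Lambda_poly\<close> is the limit over finite sets.

  For the second half, quasi-modular forms are a ring, so it suffices that every \<open>G\<^bsub>S,N,k\<^esub>\<close> with \<open>k\<close>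
  even is quasi-modular. By Lipschitz' formula, \<open>\<Sum>\<^bsub>n\<in>\<int>\<^esub> (\<tau> + n)\<^bsup>-k\<^esup>\<close> is a multiple of
  \<open>\<Sum>\<^sub>d d\<^bsup>k-1\<^esup> e\<^bsup>2\<pi>id\<tau>\<^esup>\<close>. Putting \<open>\<tau> = mz\<close> and summing over all integers \<open>m \<in> S\<close>, where \<open>m\<close> and
  \<open>-m\<close> contribute equally since \<open>S\<close> is symmetric, shows that \<open>G\<^bsub>S,N,k\<^esub>\<close> is, up to scaling and a constant,
  the Eisenstein series \<open>\<Sum> (mz + n)\<^bsup>-k\<^esup>\<close> over \<open>m \<in> S\<close>, \<open>n \<in> \<int>\<close>; the group \<open>\<Gamma>\<^sub>1(N)\<close> permutes these
  pairs \<open>(m, n)\<close>.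

  For \<open>k = 2\<close> that double series does not converge absolutely. The remedy is the one that leads to the
  Weierstrass \<open>\<wp>\<close>-function: for each class \<open>(r, s)\<close> modulo \<open>N\<close>, subtract the sum over the lattice
  \<open>N\<int>\<^sup>2\<close> term by term. The resulting series \<open>eisenstein 2 N r s\<close> transform with weight \<open>2\<close> into
  one another, \<open>\<Gamma>\<^sub>1(N)\<close> permutes those with the same \<open>r\<close>, and the subtracted part reappears in the \<open>q\<close>-expansion as a multiple of \<open>\<Sum> \<sigma>(n) q\<^sup>n = (1 - E\<^sub>2) / 24\<close> plus a constant.
  This is how \<open>E\<^sub>2\<close> enters. The pieces are \<open>slash_eisenstein\<close>, \<open>eisenstein_cong\<close>,
  \<open>eisenstein_holomorphic_at_infinity\<close> and \<open>residue_eisenstein_eq\<close>.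
\<close>

section \<open>Power sums against a geometric series\<close>

text \<open>
  The polylogarithm of order \<open>-n\<close>. With the convention \<open>0\<^sup>0 = 1\<close> the summand at \<open>d = 0\<close> is \<open>1\<close>
  for \<open>n = 0\<close> and vanishes for \<open>n > 0\<close>.
\<close>

definition polylog_neg :: "nat \<Rightarrow> complex \<Rightarrow> complex" where
  "polylog_neg n u = (\<Sum>d. of_nat d ^ n * u ^ d)"

lemma norm_summable_powser_power:
  fixes u :: complex
  assumes "norm u < 1"
  shows "summable (\<lambda>d. norm (of_nat d ^ n * u ^ d))"
proof -
  have "summable (\<lambda>d. of_nat d ^ n * x ^ d)" if "norm x < 1" for x :: real
    using that
  proof (induction n arbitrary: x)
    case (Suc n)
    have "summable (\<lambda>d. diffs (\<lambda>d. of_nat d ^ n) d * x ^ d)"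
      by (rule termdiff_converges[OF Suc.prems]) (rule Suc.IH)
    then have "summable (\<lambda>d. x * (diffs (\<lambda>d. of_nat d ^ n) d * x ^ d))"
      by (rule summable_mult)
    then have "summable (\<lambda>d. of_nat (Suc d) ^ Suc n * x ^ Suc d)"
      by (simp add: diffs_def mult_ac)
    then show ?case by (subst (asm) summable_Suc_iff)
  qed (auto simp: summable_geometric)
  from this[of "norm u"] assms show ?thesis by (simp add: norm_mult norm_power)
qed

lemma polylog_neg_sums:
  "norm u < 1 \<Longrightarrow> (\<lambda>d. of_nat d ^ n * u ^ d) sums polylog_neg n u"
  unfolding polylog_neg_def
  by (rule summable_sums, rule summable_norm_cancel, rule norm_summable_powser_power)

section \<open>The generating series of one part\<close>

text \<open>
  A power series is determined by its logarithmic derivative and its constant term, as one sees by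
  comparing coefficients. This is how identities for \<open>exp \<circ> L\<close> are proved below.
\<close>

lemma fps_log_deriv_unique:
  fixes F G D :: "'a::field_char_0 fps"
  assumes "fps_deriv F = F * D" "fps_deriv G = G * D" "F $ 0 = G $ 0"
  shows "F = G"
proof (rule fps_ext)
  fix n show "F $ n = G $ n"
  proof (induction n rule: less_induct)
    case (less n)
    show ?case
    proof (cases n)
      case (Suc m)
      have rec: "of_nat (Suc m) * H $ Suc m = (\<Sum>i=0..m. H $ i * D $ (m - i))"
        if "fps_deriv H = H * D" for H
        using arg_cong[OF that, of "\<lambda>f. f $ m"] by (simp add: fps_mult_nth del: of_nat_Suc)
      have "(\<Sum>i=0..m. F $ i * D $ (m - i)) = (\<Sum>i=0..m. G $ i * D $ (m - i))"
        using less.IH Suc by (intro sum.cong refl arg_cong2[where f = "(*)"]) auto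
      then have "of_nat (Suc m) * F $ Suc m = of_nat (Suc m) * G $ Suc m"
        by (simp only: rec[OF assms(1)] rec[OF assms(2)])
      then show ?thesis unfolding Suc by (simp del: of_nat_Suc)
    qed (simp add: assms(3))
  qed
qed

lemma fps_exp_compose_add:
  fixes a b :: "'a::field_char_0 fps"
  assumes "a $ 0 = 0" "b $ 0 = 0"
  shows "fps_exp 1 oo (a + b) = (fps_exp 1 oo a) * (fps_exp 1 oo b)"
  by (rule fps_log_deriv_unique[where D = "fps_deriv a + fps_deriv b"])
     (use assms in \<open>simp_all add: fps_compose_deriv algebra_simps\<close>)

lemma fps_exp_compose_sum:
  fixes a :: "'b \<Rightarrow> 'a::field_char_0 fps"
  assumes "finite U" "\<And>m. m \<in> U \<Longrightarrow> a m $ 0 = 0"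
  shows "fps_exp 1 oo (\<Sum>m\<in>U. a m) = (\<Prod>m\<in>U. fps_exp 1 oo a m)"
  using assms by (induction U) (auto simp: fps_exp_compose_add fps_sum_nth)

text \<open>
  A finite form of \<open>\<Sum>\<^sub>d u\<^sup>d sin d\<theta> = u sin \<theta> / (1 - 2 u cos \<theta> + u\<^sup>2)\<close>, with the boundary terms explicit.
  Multiplication by \<open>1 - 2 u cos \<theta> + u\<^sup>2\<close> telescopes the sum because
  \<open>2 cos \<theta> sin d\<theta> = sin (d+1)\<theta> + sin (d-1)\<theta>\<close>. The limit is taken afterwards, in each
  coefficient with respect to \<open>\<theta>\<close>.
\<close>

lemma damped_sine_partial_sum:
  fixes u :: "'a::field_char_0"
  shows "(1 - fps_const (2 * u) * fps_cos 1 + fps_const (u\<^sup>2)) *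
           (\<Sum>d<D. fps_const (u ^ d) * fps_sin (of_nat d)) =
         fps_const u * fps_sin 1 - fps_const (u ^ D) * fps_sin (of_nat D) +
           fps_const (u ^ Suc D) * fps_sin (of_nat D - 1)"
proof (induction D)
  case 0
  then show ?case using fps_sin_even[of "1::'a"] by simp
next
  case (Suc D)
  have sin2: "fps_sin (of_nat D + 1) + fps_sin (of_nat D - 1) = 2 * fps_cos 1 * fps_sin (of_nat D :: 'a)"
    using fps_sin_add[of "of_nat D" "1::'a"] fps_sin_add[of "of_nat D" "-1::'a"]
      fps_sin_even[of "1::'a"] fps_cos_odd[of "1::'a"]
    by (simp add: algebra_simps)
  have "fps_const (2 * u) * fps_cos 1 * fps_sin (of_nat D) =
        fps_const u * (2 * fps_cos 1 * fps_sin (of_nat D))"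
    by (simp add: numeral_fps_const flip: fps_const_mult)
  also have "\<dots> = fps_const u * (fps_sin (of_nat D + 1) + fps_sin (of_nat D - 1))"
    by (simp only: sin2)
  finally have *: "fps_const (2 * u) * fps_cos 1 * fps_sin (of_nat D) = \<dots>" .
  have "(1 - fps_const (2 * u) * fps_cos 1 + fps_const (u\<^sup>2)) * (fps_const (u ^ D) * fps_sin (of_nat D)) =
        fps_const (u ^ D) * fps_sin (of_nat D) + fps_const (u\<^sup>2) * fps_const (u ^ D) * fps_sin (of_nat D)
         - fps_const (u ^ D) * (fps_const (2 * u) * fps_cos 1 * fps_sin (of_nat D))"
    by (simp add: algebra_simps del: fps_const_mult)
  then show ?case
    unfolding sum.lessThan_Suc distrib_left Suc.IH *
    by (simp add: algebra_simps power2_eq_square flip: fps_const_mult)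
qed

text \<open>
  The coefficientwise value of \<open>\<Sum>\<^sub>d u\<^sup>d sin d\<theta>\<close>: the coefficient of \<open>\<theta>\<^sup>n\<close> in \<open>sin d\<theta>\<close> is \<open>d\<^sup>n\<close> times that
  in \<open>sin \<theta>\<close>.
\<close>

definition damped_sine :: "complex \<Rightarrow> complex fps" where
  "damped_sine u = Abs_fps (\<lambda>n. fps_sin 1 $ n * polylog_neg n u)"

lemma fps_sin_nth_scale: "fps_sin c $ n = fps_sin 1 $ n * c ^ n"
  by (simp add: fps_sin_def)

lemma damped_sine_eq:
  assumes "norm u < 1"
  shows "(1 - fps_const (2 * u) * fps_cos 1 + fps_const (u\<^sup>2)) * damped_sine u = fps_const u * fps_sin 1"
    (is "?K * _ = _")
proof (rule fps_ext)
  fix n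
  let ?Z = "\<lambda>D. \<Sum>d<D. fps_const (u ^ d) * fps_sin (of_nat d)"
  have Z: "(\<lambda>D. ?Z D $ i) \<longlonglongrightarrow> damped_sine u $ i" for i
  proof -
    have "(\<lambda>d. fps_sin 1 $ i * (of_nat d ^ i * u ^ d)) sums (fps_sin 1 $ i * polylog_neg i u)"
      by (intro sums_mult polylog_neg_sums assms)
    then have "(\<lambda>d. (fps_const (u ^ d) * fps_sin (of_nat d)) $ i) sums (damped_sine u $ i)"
      by (simp add: damped_sine_def fps_sin_nth_scale[of "of_nat _"] mult_ac)
    then show ?thesis by (simp add: sums_def fps_sum_nth)
  qed
  have lhs: "(\<lambda>D. (?K * ?Z D) $ n) \<longlonglongrightarrow> (?K * damped_sine u) $ n"
    unfolding fps_mult_nth by (intro tendsto_intros Z)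
  have small: "(\<lambda>D. of_nat D ^ i * u ^ D) \<longlonglongrightarrow> 0" for i
    by (rule summable_LIMSEQ_zero, rule summable_norm_cancel, rule norm_summable_powser_power[OF assms])
  have 1: "(\<lambda>D. (fps_const (u ^ D) * fps_sin (of_nat D)) $ n) \<longlonglongrightarrow> 0"
    using tendsto_mult_right_zero[OF small[of n], of "fps_sin 1 $ n"]
    by (simp add: fps_sin_nth_scale[of "of_nat _"] mult_ac)
  have "(\<lambda>D. (fps_const (u ^ Suc (Suc D)) * fps_sin (of_nat (Suc D) - 1)) $ n) \<longlonglongrightarrow> 0"
    using tendsto_mult_right_zero[OF small[of n], of "u\<^sup>2 * fps_sin 1 $ n"]
    by (simp add: fps_sin_nth_scale[of "of_nat _"] mult_ac power2_eq_square)
  then have 2: "(\<lambda>D. (fps_const (u ^ Suc D) * fps_sin (of_nat D - 1)) $ n) \<longlonglongrightarrow> 0"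
    by (subst (asm) filterlim_sequentially_Suc)
  have "(\<lambda>D. (?K * ?Z D) $ n) \<longlonglongrightarrow> (fps_const u * fps_sin 1) $ n - 0 + 0"
    unfolding damped_sine_partial_sum fps_add_nth fps_sub_nth
    by (intro tendsto_intros 1 2)
  with lhs show "(?K * damped_sine u) $ n = (fps_const u * fps_sin 1) $ n"
    using LIMSEQ_unique by fastforce
qed

text \<open>
  Differentiation in \<open>\<theta>\<close> removes the denominators \<open>d\<close> from \<open>2 \<Sum>\<^sub>d u\<^sup>d (1 - cos d\<theta>) / d\<close>.
\<close>

lemma fps_deriv_Lambda_exponent_polylog:
  "fps_deriv (Lambda_exponent (\<lambda>j. polylog_neg (j - 1) u)) = 2 * damped_sine u"
proof (rule fps_ext)
  fix n
  show "fps_deriv (Lambda_exponent (\<lambda>j. polylog_neg (j - 1) u)) $ n = (2 * damped_sine u) $ n"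
  proof (cases "odd n")
    case True
    then have "(Suc n) div 2 - 1 = (n - 1) div 2" by (elim oddE) auto
    moreover have "(2 * damped_sine u) $ n = 2 * damped_sine u $ n"
      by (simp add: numeral_fps_const)
    moreover have "of_nat (Suc n) \<noteq> (0::complex)" using of_nat_neq_0 by blast
    ultimately show ?thesis using True
      by (simp add: Lambda_exponent_def damped_sine_def fps_sin_def field_simps del: of_nat_Suc)
  qed (simp add: Lambda_exponent_def damped_sine_def fps_sin_def numeral_fps_const)
qed

text \<open>
  Both sides have constant term \<open>1\<close> and logarithmic derivative \<open>2 \<Sum>\<^sub>d u\<^sup>d sin d\<theta>\<close>; for the right-hand
  side this is the closed form of that series, because the right-hand side equals
  \<open>(1 - 2 u cos \<theta> + u\<^sup>2) / (1 - u)\<^sup>2\<close>.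
\<close>

lemma fps_exp_Lambda_exponent_polylog:
  assumes "norm u < 1"
  shows "fps_exp 1 oo Lambda_exponent (\<lambda>j. polylog_neg (j - 1) u) =
         1 + fps_const (u / (1 - u)\<^sup>2) * (2 - 2 * fps_cos 1)" (is "?E = ?H")
proof (rule fps_log_deriv_unique)
  have u: "1 - u \<noteq> 0" using assms by auto
  show "fps_deriv ?E = ?E * (2 * damped_sine u)"
    by (simp add: fps_compose_deriv Lambda_exponent_def flip: fps_deriv_Lambda_exponent_polylog)
  have "?H = fps_const (1 / (1 - u)\<^sup>2) * (fps_const ((1 - u)\<^sup>2) + fps_const u * (2 - 2 * fps_cos 1))"
    using u by (simp add: distrib_left mult.assoc[symmetric])
  also have "fps_const ((1 - u)\<^sup>2) + fps_const u * (2 - 2 * fps_cos 1) =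
      1 - fps_const (2 * u) * fps_cos 1 + fps_const (u\<^sup>2)"
    by (simp add: algebra_simps power2_eq_square numeral_fps_const flip: fps_const_mult fps_const_add fps_const_sub)
  finally have "?H * damped_sine u = fps_const (1 / (1 - u)\<^sup>2) * (fps_const u * fps_sin 1)"
    by (simp only: mult.assoc damped_sine_eq[OF assms])
  moreover have "?H * (2 * damped_sine u) = 2 * (?H * damped_sine u)"
    by (rule mult.left_commute)
  ultimately have "?H * (2 * damped_sine u) = 2 * ((fps_const (1 / (1 - u)\<^sup>2) * fps_const u) * fps_sin 1)"
    by (simp only: mult.assoc)
  also have "\<dots> = fps_deriv ?H"
    by (simp add: fps_cos_deriv fps_const_neg[symmetric] del: fps_const_neg)
  finally show "fps_deriv ?H = ?H * (2 * damped_sine u)" ..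
  show "?E $ 0 = ?H $ 0" by simp
qed

lemma two_arcsin_half_nth_0: "two_arcsin_half $ 0 = 0"
  by (simp add: two_arcsin_half_def fps_arcsin_def fps_inv_def)

text \<open>
  \<open>2 - 2 cos \<theta> = (2 sin (\<theta>/2))\<^sup>2\<close>, and \<open>2 sin (\<theta>/2) = X\<close> for \<open>\<theta> = 2 arcsin (X/2)\<close>.
\<close>

lemma fps_cos_two_arcsin_half:
  "2 - 2 * (fps_cos 1 oo two_arcsin_half) = (fps_X\<^sup>2 :: complex fps)"
proof -
  let ?T = "two_arcsin_half :: complex fps"
  have half: "fps_cos 1 = (fps_cos (1/2))\<^sup>2 - (fps_sin (1/2 :: complex))\<^sup>2"
    using fps_cos_add[of "1/2::complex" "1/2"] by (simp add: power2_eq_square)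
  have eq: "2 - 2 * fps_cos 1 = 4 * fps_sin (1/2) * fps_sin (1/2 :: complex)"
  proof -
    have "2 - 2 * fps_cos 1 =
        2 - 2 * ((fps_cos (1/2))\<^sup>2 + (fps_sin (1/2))\<^sup>2) + 4 * fps_sin (1/2) * fps_sin (1/2 :: complex)"
      unfolding half by (simp add: algebra_simps power2_eq_square)
    then show ?thesis unfolding fps_sin_cos_sum_of_squares by simp
  qed
  have lin: "fps_sin (1/2) = fps_sin 1 oo (fps_const (1/2) * fps_X :: complex fps)"
    by (subst fps_compose_linear, rule fps_ext) (simp add: fps_sin_nth_scale[of "1/2"])
  have "fps_sin (1/2) oo ?T = fps_sin 1 oo (fps_const (1/2) * fps_X oo ?T)"
    unfolding lin by (subst fps_compose_assoc) (auto simp: two_arcsin_half_nth_0)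
  also have "fps_const (1/2) * fps_X oo ?T = fps_const (1/2) * ?T"
    by (simp add: fps_compose_mult_distrib two_arcsin_half_nth_0 fps_X_fps_compose_startby0)
  also have "\<dots> = fps_arcsin oo (fps_const (1/2) * fps_X)"
    by (simp add: two_arcsin_half_def mult.assoc[symmetric])
  also have "fps_sin 1 oo \<dots> = (fps_sin 1 oo fps_arcsin) oo (fps_const (1/2) * fps_X)"
    by (subst fps_compose_assoc) (auto simp: fps_arcsin_def fps_inv_def)
  also have "\<dots> = fps_const (1/2) * fps_X"
    unfolding fps_arcsin_def by (subst fps_inv_right) (auto simp: fps_X_fps_compose_startby0)
  finally have half_sin: "fps_sin (1/2) oo ?T = fps_const (1/2) * fps_X" .
  have "2 - 2 * (fps_cos 1 oo ?T) = (2 - 2 * fps_cos 1) oo ?T"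
    by (simp add: fps_compose_sub_distrib fps_compose_mult_distrib two_arcsin_half_nth_0)
  also have "\<dots> = 4 * (fps_const (1/2) * fps_X) * (fps_const (1/2) * fps_X)"
    unfolding eq by (simp add: fps_compose_mult_distrib two_arcsin_half_nth_0 half_sin)
  also have "\<dots> = (fps_const 4 * fps_const (1/2) * fps_const (1/2)) * fps_X\<^sup>2"
    unfolding power2_eq_square numeral_fps_const by (simp only: mult_ac)
  finally show ?thesis by simp
qed

lemma Lambda_generating_series_polylog:
  assumes "norm u < 1"
  shows "fps_exp 1 oo (Lambda_exponent (\<lambda>j. polylog_neg (j - 1) u) oo two_arcsin_half) =
         1 + fps_const (u / (1 - u)\<^sup>2) * fps_X\<^sup>2"
proof -
  have "fps_exp 1 oo (Lambda_exponent (\<lambda>j. polylog_neg (j - 1) u) oo two_arcsin_half) =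
        (1 + fps_const (u / (1 - u)\<^sup>2) * (2 - 2 * fps_cos 1)) oo two_arcsin_half"
    using fps_exp_Lambda_exponent_polylog[OF assms]
    by (subst fps_compose_assoc) (auto simp: two_arcsin_half_nth_0 Lambda_exponent_def)
  also have "\<dots> = 1 + fps_const (u / (1 - u)\<^sup>2) * (2 - 2 * (fps_cos 1 oo two_arcsin_half))"
    by (simp add: fps_compose_add_distrib fps_compose_sub_distrib fps_compose_mult_distrib two_arcsin_half_nth_0)
  finally show ?thesis unfolding fps_cos_two_arcsin_half .
qed

section \<open>From one part to all parts\<close>

lemma Lambda_exponent_sum:
  "Lambda_exponent (\<lambda>j. \<Sum>m\<in>U. x m j) = (\<Sum>m\<in>U. Lambda_exponent (x m))"
  by (rule fps_ext) (auto simp: Lambda_exponent_def fps_sum_nth sum_distrib_left)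

lemma fps_const_prod: "fps_const (\<Prod>m\<in>M. f m) = (\<Prod>m\<in>M. fps_const (f m :: 'a::comm_ring_1))"
  by (induction M rule: infinite_finite_induct) (auto simp flip: fps_const_mult)

text \<open>
  The identity of generating series for finitely many parts. The exponent is linear in the \<open>x\<^bsub>2j\<^esub>\<close>, so
  the exponential is the product of the factors of the single parts, whose expansion is the elementary
  symmetric polynomial in the \<open>u / (1 - u)\<^sup>2\<close>.
\<close>

lemma Lambda_poly_finite_sum:
  assumes "finite U" "\<And>m. m \<in> U \<Longrightarrow> norm (u m) < 1"
  shows "Lambda_poly k (\<lambda>j. \<Sum>m\<in>U. polylog_neg (j - 1) (u m)) =
         (\<Sum>M | M \<subseteq> U \<and> card M = k. \<Prod>m\<in>M. u m / (1 - u m)\<^sup>2)"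
proof -
  let ?a = "\<lambda>m. u m / (1 - u m)\<^sup>2"
  let ?L = "\<lambda>m. Lambda_exponent (\<lambda>j. polylog_neg (j - 1) (u m)) oo two_arcsin_half"
  have fin: "finite M" if "M \<subseteq> U" for M using assms(1) that finite_subset by auto
  have "fps_exp 1 oo (Lambda_exponent (\<lambda>j. \<Sum>m\<in>U. polylog_neg (j - 1) (u m)) oo two_arcsin_half) =
        (\<Prod>m\<in>U. fps_exp 1 oo ?L m)"
    unfolding Lambda_exponent_sum fps_compose_sum_distrib
    by (rule fps_exp_compose_sum) (auto simp: assms Lambda_exponent_def)
  also have "\<dots> = (\<Prod>m\<in>U. fps_const (?a m) * fps_X\<^sup>2 + 1)"
    by (intro prod.cong refl, subst Lambda_generating_series_polylog) (auto simp: assms)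
  also have "\<dots> = (\<Sum>M\<in>Pow U. \<Prod>m\<in>M. fps_const (?a m) * fps_X\<^sup>2)"
    by (subst prod_add[OF assms(1)]) simp
  also have "\<dots> = (\<Sum>M\<in>Pow U. fps_const (\<Prod>m\<in>M. ?a m) * fps_X ^ (2 * card M))"
    by (intro sum.cong refl) (simp add: prod.distrib fps_const_prod flip: power_mult)
  finally have "Lambda_poly k (\<lambda>j. \<Sum>m\<in>U. polylog_neg (j - 1) (u m)) =
      (\<Sum>M\<in>Pow U. if card M = k then \<Prod>m\<in>M. ?a m else 0)"
    unfolding Lambda_poly_def by (auto simp: fps_sum_nth intro!: sum.cong)
  also have "\<dots> = (\<Sum>M | M \<subseteq> U \<and> card M = k. \<Prod>m\<in>M. ?a m)"
    using assms(1) by (subst sum.If_cases) (auto intro!: sum.cong)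
  finally show ?thesis .
qed

text \<open>
  That \<open>\<Lambda>\<^sub>k\<close> is a polynomial in \<open>x\<^sub>2, \<dots>, x\<^bsub>2k\<^esub>\<close> is used in one form only: a set of functions that is
  closed under constants, sums and products contains \<open>\<Lambda>\<^sub>k(x\<^sub>2, \<dots>, x\<^bsub>2k\<^esub>)\<close> together with the functions
  \<open>x\<^bsub>2j\<^esub>\<close>. It is applied to convergent families, where it gives the continuity of \<open>\<Lambda>\<^sub>k\<close>, and to
  quasi-modular forms.
\<close>

locale function_algebra =
  fixes R :: "('b \<Rightarrow> complex) set"
  assumes const: "(\<lambda>_. c) \<in> R"
    and add: "f \<in> R \<Longrightarrow> g \<in> R \<Longrightarrow> (\<lambda>z. f z + g z) \<in> R"
    and mult: "f \<in> R \<Longrightarrow> g \<in> R \<Longrightarrow> (\<lambda>z. f z * g z) \<in> R"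
begin

lemma sum_mem:
  assumes "\<And>i. i \<in> I \<Longrightarrow> f i \<in> R"
  shows "(\<lambda>z. \<Sum>i\<in>I. f i z) \<in> R"
  using assms by (induction I rule: infinite_finite_induct) (auto intro: const add)

lemma Lambda_poly_mem:
  assumes x: "\<And>j. 1 \<le> j \<Longrightarrow> j \<le> k \<Longrightarrow> (\<lambda>z. x z (2 * j)) \<in> R"
  shows "(\<lambda>z. Lambda_poly k (x z)) \<in> R"
proof -
  let ?F = "\<lambda>z. Lambda_exponent (x z) oo two_arcsin_half"
  have L: "(\<lambda>z. Lambda_exponent (x z) $ n) \<in> R" if "n \<le> 2 * k" for n
  proof (cases "even n \<and> n > 0")
    case True
    then obtain j where "n = 2 * j" by (auto elim!: evenE)
    with True that have j: "n = 2 * j" "1 \<le> j" "j \<le> k" by auto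
    have "(\<lambda>z. (2 * ((- 1) ^ (n div 2 - 1) / fact n)) * x z (2 * j)) \<in> R"
      by (intro mult const x j)
    then show ?thesis using True j by (simp add: Lambda_exponent_def mult.assoc)
  qed (auto simp: Lambda_exponent_def const)
  have F: "(\<lambda>z. ?F z $ n) \<in> R" if "n \<le> 2 * k" for n
    unfolding fps_compose_nth using that by (intro sum_mem mult const L) auto
  have P: "(\<lambda>z. (?F z ^ i) $ n) \<in> R" if "n \<le> 2 * k" for n i
    using that
  proof (induction i arbitrary: n)
    case (Suc i)
    show ?case
      unfolding power_Suc fps_mult_nth using Suc by (intro sum_mem mult F) auto
  qed (auto simp: const)
  show ?thesis
    unfolding Lambda_poly_def fps_compose_nth[of "fps_exp 1"] by (intro sum_mem mult const P) auto
qed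

end

lemma tendsto_Lambda_poly:
  fixes x :: "'b \<Rightarrow> nat \<Rightarrow> complex"
  assumes "\<And>j. 1 \<le> j \<Longrightarrow> j \<le> k \<Longrightarrow> ((\<lambda>U. x U (2 * j)) \<longlongrightarrow> y (2 * j)) F"
  shows "((\<lambda>U. Lambda_poly k (x U)) \<longlongrightarrow> Lambda_poly k y) F"
proof -
  \<comment> \<open>The extra point \<open>None\<close> carries the limit: \<open>R\<close> consists of the families that converge to their value there.\<close>
  define R where "R = {f :: 'b option \<Rightarrow> complex. ((\<lambda>U. f (Some U)) \<longlongrightarrow> f None) F}"
  interpret function_algebra R
    by unfold_locales (auto simp: R_def intro: tendsto_intros)
  have "(\<lambda>z. Lambda_poly k (case z of None \<Rightarrow> y | Some U \<Rightarrow> x U)) \<in> R"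
    by (rule Lambda_poly_mem) (use assms in \<open>auto simp: R_def\<close>)
  then show ?thesis by (simp add: R_def)
qed

text \<open>
  The positive integers whose residue lies in \<open>S\<close>, that is, the admissible parts.
\<close>

definition residue_class_union :: "int set \<Rightarrow> nat \<Rightarrow> nat set" where
  "residue_class_union S N = {m. 0 < m \<and> residue_in S N m}"

lemma polylog_neg_has_sum:
  assumes "norm u < 1" "n > 0"
  shows "((\<lambda>d. of_nat d ^ n * u ^ d) has_sum polylog_neg n u) {1..}"
proof -
  have "((\<lambda>d. of_nat d ^ n * u ^ d) has_sum polylog_neg n u) UNIV"
    by (intro norm_summable_imp_has_sum norm_summable_powser_power polylog_neg_sums assms)
  also have "?this \<longleftrightarrow> ?thesis"
    using assms(2) by (intro has_sum_cong_neutral) auto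
  finally show ?thesis .
qed

text \<open>
  The Lambert series form of the divisor sums: substitute \<open>n = md\<close>. The requirement \<open>j \<ge> 2\<close> makes the
  summand \<open>d = 0\<close> of \<open>polylog_neg (j - 1)\<close> vanish.
\<close>

lemma macmahon_G_Lambert:
  assumes q: "norm q < 1" and j: "j \<ge> 2"
  shows "((\<lambda>m. polylog_neg (j - 1) (q ^ m)) has_sum macmahon_G S N j q) (residue_class_union S N)"
proof -
  let ?D = "\<lambda>n. {d. d dvd n \<and> residue_in S N (n div d)}"
  let ?f = "\<lambda>(n,d). of_nat d ^ (j - 1) * q ^ n :: complex"
  let ?c = "\<lambda>n. (\<Sum>d\<in>?D n. d ^ (j - 1))"
  have fin: "finite (?D n)" if "n \<in> {1..}" for n
    using that by (intro finite_subset[OF _ finite_divisors_nat]) auto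
  have "(\<lambda>x. norm (?f x)) summable_on Sigma {1..} ?D"
  proof (rule summable_on_SigmaI)
    show "((\<lambda>d. norm (?f (n, d))) has_sum norm (of_nat (?c n) * q ^ n)) (?D n)" if "n \<in> {1..}" for n
      by (rule has_sum_finiteI[OF fin[OF that]])
         (simp add: norm_mult norm_power sum_distrib_right del: of_nat_sum, simp add: sum_distrib_right)
    show "(\<lambda>n. norm (of_nat (?c n) * q ^ n)) summable_on {1..}"
      by (rule macmahon_G_summable[OF q])
  qed auto
  then have f: "?f summable_on Sigma {1..} ?D"
    by (rule abs_summable_summable)
  have "(?f has_sum macmahon_G S N j q) (Sigma {1..} ?D)"
  proof (rule has_sum_SigmaI[OF _ _ f])
    show "((\<lambda>d. ?f (n, d)) has_sum of_nat (?c n) * q ^ n) (?D n)" if "n \<in> {1..}" for n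
      by (rule has_sum_finiteI[OF fin[OF that]]) (simp add: sum_distrib_right)
    show "((\<lambda>n. of_nat (?c n) * q ^ n) has_sum macmahon_G S N j q) {1..}"
      unfolding macmahon_G_def
      by (rule has_sum_infsum, rule abs_summable_summable, rule macmahon_G_summable[OF q])
  qed
  also have "?this \<longleftrightarrow> ((\<lambda>(m,d). of_nat d ^ (j - 1) * (q ^ m) ^ d) has_sum macmahon_G S N j q)
      (residue_class_union S N \<times> {1..})"
    by (rule has_sum_reindex_bij_witness[of _ "\<lambda>(m,d). (m * d, d)" "\<lambda>(n,d). (n div d, d)"])
       (auto simp: residue_class_union_def Suc_le_eq mult_ac simp flip: power_mult elim!: dvdE)
  finally show ?thesis
  proof (rule has_sum_SigmaD)
    fix m assume "m \<in> residue_class_union S N"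
    then have "norm (q ^ m) < 1"
      using q by (auto simp: residue_class_union_def norm_power power_less_one_iff)
    then show "((\<lambda>d. case (m, d) of (m, d) \<Rightarrow> of_nat d ^ (j - 1) * (q ^ m) ^ d) has_sum
        polylog_neg (j - 1) (q ^ m)) {1..}"
      using polylog_neg_has_sum[of "q ^ m" "j - 1"] j by simp
  qed
qed

text \<open>
  The identity for finite sets \<open>U\<close> of parts passes to the limit along the filter of finite subsets. On
  the side of \<open>A\<close> the \<open>k\<close>-element subsets of \<open>U\<close> exhaust all admissible tuples, so an infinite sum over
  tuples becomes a limit over \<open>U\<close>.
\<close>

lemma macmahon_A_eq_Lambda_poly:
  assumes q: "norm q < 1"
  shows "macmahon_A S N k q = Lambda_poly k (\<lambda>j. macmahon_G S N j q)"
proof -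
  let ?I = "residue_class_union S N"
  let ?F = "finite_subsets_at_top ?I"
  let ?g = "\<lambda>M. \<Prod>m\<in>M. q ^ m / (1 - q ^ m)\<^sup>2"
  have tuples: "macmahon_tuples S N k = {M. finite M \<and> M \<subseteq> ?I \<and> card M = k}"
    by (auto simp: macmahon_tuples_def residue_class_union_def)
  have exhaust: "filterlim (\<lambda>U. {M. M \<subseteq> U \<and> card M = k}) (finite_subsets_at_top (macmahon_tuples S N k)) ?F"
    unfolding filterlim_finite_subsets_at_top
  proof (intro allI impI)
    fix X assume X: "finite X \<and> X \<subseteq> macmahon_tuples S N k"
    show "\<forall>\<^sub>F U in ?F. finite {M. M \<subseteq> U \<and> card M = k} \<and> X \<subseteq> {M. M \<subseteq> U \<and> card M = k} \<and>
            {M. M \<subseteq> U \<and> card M = k} \<subseteq> macmahon_tuples S N k"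
      unfolding eventually_finite_subsets_at_top
      by (rule exI[of _ "\<Union>X"]) (use X in \<open>auto simp: tuples intro: finite_subset\<close>)
  qed
  have "(?g has_sum macmahon_A S N k q) (macmahon_tuples S N k)"
    unfolding macmahon_A_def by (rule has_sum_infsum, rule abs_summable_summable, rule macmahon_A_summable[OF q])
  then have "((\<lambda>U. sum ?g {M. M \<subseteq> U \<and> card M = k}) \<longlongrightarrow> macmahon_A S N k q) ?F"
    unfolding has_sum_def using exhaust by (rule filterlim_compose)
  moreover have "\<forall>\<^sub>F U in ?F. sum ?g {M. M \<subseteq> U \<and> card M = k} =
      Lambda_poly k (\<lambda>j. \<Sum>m\<in>U. polylog_neg (j - 1) (q ^ m))"
  proof (rule eventually_finite_subsets_at_top_weakI)
    fix U assume "finite U" "U \<subseteq> ?I"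
    then show "sum ?g {M. M \<subseteq> U \<and> card M = k} = Lambda_poly k (\<lambda>j. \<Sum>m\<in>U. polylog_neg (j - 1) (q ^ m))"
      using q by (subst Lambda_poly_finite_sum)
        (auto simp: residue_class_union_def norm_power power_less_one_iff)
  qed
  ultimately have "((\<lambda>U. Lambda_poly k (\<lambda>j. \<Sum>m\<in>U. polylog_neg (j - 1) (q ^ m))) \<longlongrightarrow> macmahon_A S N k q) ?F"
    by (simp cong: tendsto_cong)
  moreover have "((\<lambda>U. Lambda_poly k (\<lambda>j. \<Sum>m\<in>U. polylog_neg (j - 1) (q ^ m))) \<longlongrightarrow>
      Lambda_poly k (\<lambda>j. macmahon_G S N j q)) ?F"
    by (rule tendsto_Lambda_poly, rule macmahon_G_Lambert[OF q, unfolded has_sum_def]) auto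
  ultimately show ?thesis by (rule tendsto_unique[rotated]) simp
qed

section \<open>Sums over the integers and over a plane lattice\<close>

lemma summable_on_int_from_nat:
  fixes f :: "int \<Rightarrow> real"
  assumes "summable (\<lambda>n. f (int n))" "\<And>n. f n \<ge> 0" "\<And>n. f (- n) = f n"
  shows "f summable_on UNIV"
proof -
  have nat: "(\<lambda>n. f (int n)) summable_on UNIV"
    using assms by (intro summable_nonneg_imp_summable_on) auto
  have "f summable_on range int"
    using nat by (subst summable_on_reindex) (auto simp: o_def)
  moreover have "f summable_on range (\<lambda>n. - int n)"
    using nat by (subst summable_on_reindex) (auto simp: o_def assms(3) intro!: injI)
  moreover have "range int \<union> range (\<lambda>n. - int n) = UNIV"
    by (auto simp: image_iff) (metis int_cases2)
  ultimately show ?thesis using summable_on_union by metis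
qed

lemma summable_on_int_powr:
  assumes "s > 1"
  shows "(\<lambda>n::int. (1 + \<bar>real_of_int n\<bar>) powr (- s)) summable_on UNIV"
proof (rule summable_on_int_from_nat)
  have "summable (\<lambda>n. real (Suc n) powr (- s))"
    using assms by (subst summable_Suc_iff) (simp add: summable_real_powr_iff)
  then show "summable (\<lambda>n. (1 + \<bar>real_of_int (int n)\<bar>) powr (- s))" by (simp add: add.commute)
qed auto

text \<open>
  \<open>1 + |a| + |b|\<close> is at least \<open>1 + |a|\<close> and at least \<open>1 + |b|\<close>, so its cube is at least the product of
  their powers with exponent \<open>3/2\<close>, and the double series is dominated by a product of two convergent
  series.
\<close>

lemma summable_on_lattice_cubes:
  "(\<lambda>(a, b). 1 / (1 + \<bar>real_of_int a\<bar> + \<bar>real_of_int b\<bar>) ^ 3) summable_on UNIV"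
proof (rule summable_on_comparison_test)
  let ?g = "\<lambda>a::int. (1 + \<bar>real_of_int a\<bar>) powr (- (3/2))"
  have g: "?g summable_on UNIV" by (rule summable_on_int_powr) simp
  have "(\<lambda>(a, b). ?g a * ?g b) summable_on (UNIV \<times> UNIV)"
    by (rule summable_on_SigmaI[where g = "\<lambda>a. ?g a * infsum ?g UNIV"])
       (auto intro!: has_sum_cmult_right has_sum_infsum summable_on_cmult_left g)
  then show "(\<lambda>(a, b). ?g a * ?g b) summable_on UNIV" by simp
  fix x :: "int \<times> int"
  obtain a b where x: "x = (a, b)" by (cases x)
  define s where "s = 1 + \<bar>real_of_int a\<bar> + \<bar>real_of_int b\<bar>"
  have s: "s > 0" by (simp add: s_def)
  have "(1 / s) ^ 3 = s powr (- 3)"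
    using s by (simp add: powr_minus powr_numeral power_one_over inverse_eq_divide)
  also have "\<dots> = s powr (- (3/2)) * s powr (- (3/2))"
    by (simp flip: powr_add)
  also have "\<dots> \<le> ?g a * ?g b"
    by (intro mult_mono powr_mono2') (auto simp: s_def)
  finally show "(case x of (a, b) \<Rightarrow> 1 / (1 + \<bar>real_of_int a\<bar> + \<bar>real_of_int b\<bar>) ^ 3) \<le>
      (case x of (a, b) \<Rightarrow> ?g a * ?g b)"
    by (simp add: x s_def power_one_over)
qed auto

definition lattice_point :: "complex \<Rightarrow> int \<Rightarrow> int \<Rightarrow> complex" where
  "lattice_point z m n = of_int m * z + of_int n"

text \<open>
  The constant depends on the strip only, so the bound is uniform as \<open>Im z\<close> tends to infinity. This is
  what makes it usable for the growth at the cusps.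
\<close>

lemma lattice_point_bound:
  assumes "Im z \<ge> y" "y > 0" "\<bar>Re z\<bar> \<le> R"
  shows "\<bar>real_of_int m\<bar> + \<bar>real_of_int n\<bar> \<le> (1 + (1 + R) / y) * norm (lattice_point z m n)"
proof -
  let ?l = "lattice_point z m n"
  have "\<bar>real_of_int m\<bar> * y \<le> \<bar>real_of_int m\<bar> * Im z"
    using assms by (intro mult_left_mono) auto
  also have "\<dots> = \<bar>Im ?l\<bar>" using assms by (simp add: lattice_point_def abs_mult)
  also have "\<dots> \<le> norm ?l" by (rule abs_Im_le_cmod)
  finally have m: "\<bar>real_of_int m\<bar> \<le> norm ?l / y" using assms by (simp add: field_simps)
  have "\<bar>real_of_int n\<bar> = \<bar>Re ?l - real_of_int m * Re z\<bar>" by (simp add: lattice_point_def)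
  also have "\<dots> \<le> \<bar>Re ?l\<bar> + \<bar>real_of_int m\<bar> * \<bar>Re z\<bar>" by (simp add: abs_mult[symmetric])
  also have "\<dots> \<le> norm ?l + norm ?l / y * R"
    using assms m by (intro add_mono abs_Re_le_cmod mult_mono) auto
  finally show ?thesis using m by (simp add: field_simps add_divide_distrib)
qed

lemma lattice_point_eq_0_iff:
  assumes "Im z > 0"
  shows "lattice_point z m n = 0 \<longleftrightarrow> m = 0 \<and> n = 0"
  using assms by (auto simp: lattice_point_def complex_eq_iff)

lemma norm_nome_less_1: "Im z > 0 \<Longrightarrow> norm (nome z) < 1"
  by (simp add: nome_def)

section \<open>Lipschitz' formula\<close>

text \<open>
  The convention \<open>1 / 0 = 0\<close> drops the singular summand when \<open>\<tau>\<close> is an integer; in particular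
  \<open>row_sum k 0\<close> is \<open>2 \<zeta>(k)\<close> for even \<open>k\<close>.
\<close>

definition row_sum :: "nat \<Rightarrow> complex \<Rightarrow> complex" where
  "row_sum k \<tau> = (\<Sum>\<^sub>\<infinity>n\<in>UNIV. 1 / (\<tau> + of_int n) ^ k)"

lemma row_sum_abs_summable:
  fixes \<tau> :: complex
  assumes "k \<ge> 2"
  shows "(\<lambda>n::int. norm (1 / (\<tau> + of_int n) ^ k)) summable_on UNIV"
proof -
  define M where "M = norm \<tau> + 1"
  have "M > 0" by (simp add: M_def add_nonneg_pos)
  let ?B = "{n::int. \<bar>real_of_int n\<bar> \<le> 2 * M}"
  have "?B \<subseteq> {-\<lceil>2 * M\<rceil>..\<lceil>2 * M\<rceil>}" by (auto simp: abs_le_iff) linarith+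
  then have fin: "finite ?B" using finite_subset by blast
  have "(\<lambda>n::int. norm (1 / (\<tau> + of_int n) ^ k)) summable_on (UNIV - ?B)"
  proof (rule summable_on_comparison_test)
    have "(\<lambda>n::int. 4 ^ k * (1 + \<bar>real_of_int n\<bar>) powr (- 2)) summable_on UNIV"
      by (intro summable_on_cmult_right summable_on_int_powr) simp
    then show "(\<lambda>n::int. 4 ^ k * (1 + \<bar>real_of_int n\<bar>) powr (- 2)) summable_on (UNIV - ?B)"
      by (rule summable_on_subset) auto
    fix n :: int assume n: "n \<in> UNIV - ?B"
    define s where "s = 1 + \<bar>real_of_int n\<bar>"
    have "norm (of_int n :: complex) \<le> norm (\<tau> + of_int n) + norm \<tau>"
      using norm_triangle_ineq4[of "\<tau> + of_int n" \<tau>] by simp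
    with n have lower: "s / 4 \<le> norm (\<tau> + of_int n)" unfolding s_def by (simp add: M_def) 
    have "s \<ge> 1" by (simp add: s_def)
    have "norm (1 / (\<tau> + of_int n) ^ k) = 1 / norm (\<tau> + of_int n) ^ k"
      by (simp add: norm_divide norm_power)
    also have "\<dots> \<le> 1 / (s / 4) ^ k"
      using lower \<open>s \<ge> 1\<close> by (intro divide_left_mono power_mono mult_pos_pos zero_less_power) auto
    also have "\<dots> = 4 ^ k * (1 / s ^ k)" by (simp add: power_divide)
    also have "1 / s ^ k \<le> 1 / s ^ 2"
      using assms \<open>s \<ge> 1\<close> by (intro divide_left_mono power_increasing mult_pos_pos) auto
    also have "1 / s ^ 2 = s powr (- 2)"
      using \<open>s \<ge> 1\<close> by (simp add: powr_minus powr_numeral inverse_eq_divide)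
    finally show "norm (1 / (\<tau> + of_int n) ^ k) \<le> 4 ^ k * (1 + \<bar>real_of_int n\<bar>) powr (- 2)"
      by (simp add: s_def)
  qed auto
  moreover have "(\<lambda>n::int. norm (1 / (\<tau> + of_int n) ^ k)) summable_on ?B"
    using fin by simp
  ultimately show ?thesis
    using summable_on_union[of "\<lambda>n::int. norm (1 / (\<tau> + of_int n) ^ k)" "UNIV - ?B" ?B] by simp
qed

lemma row_sum_has_sum:
  assumes "k \<ge> 2"
  shows "((\<lambda>n::int. 1 / (\<tau> + of_int n) ^ k) has_sum row_sum k \<tau>) UNIV"
  unfolding row_sum_def
  by (rule has_sum_infsum, rule abs_summable_summable, rule row_sum_abs_summable[OF assms])

lemma row_sum_uminus:
  assumes "even k"
  shows "row_sum k (- \<tau>) = row_sum k \<tau>"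
proof -
  have "(-\<tau> + of_int n) ^ k = (\<tau> + of_int (- n)) ^ k" for n :: int
    using assms uminus_power_if[of "\<tau> + of_int (- n)" k] by simp
  then show ?thesis
    unfolding row_sum_def
    by (intro infsum_reindex_bij_witness[of _ uminus uminus]) (simp_all del: of_int_minus)
qed

text \<open>
  The polygamma function is the sum over half of the integers. The other half is obtained by reflection
  \<open>\<tau> \<mapsto> 1 - \<tau>\<close>.
\<close>

lemma row_sum_Polygamma:
  assumes \<tau>: "Im \<tau> > 0" and k: "k > 0"
  shows "row_sum (Suc k) \<tau> = ((-1) ^ Suc k * Polygamma k \<tau> + Polygamma k (1 - \<tau>)) / fact k"
proof -
  let ?f = "\<lambda>n::int. 1 / (\<tau> + of_int n) ^ Suc k"
  have nz: "\<tau> \<noteq> 0" "1 - \<tau> \<noteq> 0" using \<tau> by (auto simp: complex_eq_iff)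
  have f: "?f summable_on A" for A
  proof (rule summable_on_subset)
    show "?f summable_on UNIV"
      by (rule abs_summable_summable, rule row_sum_abs_summable) (use k in simp)
  qed auto
  have pos: "infsum ?f {0..} = (-1) ^ Suc k * Polygamma k \<tau> / fact k"
  proof -
    have "(?f has_sum infsum ?f {0..}) {0..}" using f by (rule has_sum_infsum)
    also have "?this \<longleftrightarrow> ((\<lambda>n. inverse ((\<tau> + of_nat n) ^ Suc k)) has_sum infsum ?f {0..}) UNIV"
      by (rule has_sum_reindex_bij_witness[of _ int nat]) (auto simp: inverse_eq_divide)
    finally show ?thesis
      using Polygamma_LIMSEQ[OF nz(1) k] by (metis has_sum_imp_sums sums_unique2)
  qed
  have neg: "infsum ?f {..<0} = Polygamma k (1 - \<tau>) / fact k"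
  proof -
    have "(?f has_sum infsum ?f {..<0}) {..<0}" using f by (rule has_sum_infsum)
    also have "?this \<longleftrightarrow> ((\<lambda>n. (-1) ^ Suc k * inverse ((1 - \<tau> + of_nat n) ^ Suc k)) has_sum infsum ?f {..<0}) UNIV"
    proof (rule has_sum_reindex_bij_witness[of _ "\<lambda>n. - int n - 1" "\<lambda>n. nat (- n - 1)"])
      fix n :: int assume "n \<in> {..<0}"
      then have "1 - \<tau> + of_nat (nat (- n - 1)) = - (\<tau> + of_int n)" by simp
      then have "(1 - \<tau> + of_nat (nat (- n - 1))) ^ Suc k = (-1) ^ Suc k * (\<tau> + of_int n) ^ Suc k"
        by (simp only: power_minus[of "\<tau> + of_int n"])
      moreover have "(-1) ^ m * inverse ((-1) ^ m * c) = 1 / c" for m and c :: complex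
        by (cases "even m") (simp_all add: inverse_eq_divide)
      ultimately show "(-1) ^ Suc k * inverse ((1 - \<tau> + of_nat (nat (- n - 1))) ^ Suc k) = ?f n"
        by (simp only:)
    qed auto
    finally have "(\<lambda>n. (-1) ^ Suc k * inverse ((1 - \<tau> + of_nat n) ^ Suc k)) sums infsum ?f {..<0}"
      by (rule has_sum_imp_sums)
    moreover have "(\<lambda>n. (-1) ^ Suc k * inverse ((1 - \<tau> + of_nat n) ^ Suc k)) sums
        ((-1) ^ Suc k * ((-1) ^ Suc k * Polygamma k (1 - \<tau>) / fact k))"
      by (intro sums_mult Polygamma_LIMSEQ nz k)
    ultimately show ?thesis
      by (metis (no_types, lifting) sums_unique2 mult.assoc mult_minus1 mult_minus1_right
          minus_mult_minus mult_1 power_mult_distrib power_one times_divide_eq_right)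
  qed
  have split: "{0..} \<union> {..<0} = (UNIV :: int set)" "{0..} \<inter> {..<0::int} = {}" by auto
  have "row_sum (Suc k) \<tau> = infsum ?f {0..} + infsum ?f {..<0}"
    unfolding row_sum_def using infsum_Un_disjoint[OF f f split(2)] by (simp only: split(1))
  then show ?thesis by (simp only: pos neg add_divide_distrib)
qed

lemma upper_half_plane_not_Ints: "Im z > 0 \<Longrightarrow> z \<notin> \<int>" "Im z > 0 \<Longrightarrow> 1 - z \<notin> \<int>"
  by (auto elim!: Ints_cases simp: complex_eq_iff)

text \<open>
  The logarithmic derivative of the reflection formula of the Gamma function.
\<close>

lemma Digamma_reflection:
  assumes \<tau>: "Im \<tau> > 0"
  shows "Digamma (1 - \<tau>) - Digamma \<tau> = of_real pi * cot (of_real pi * \<tau>)"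
proof -
  let ?p = "complex_of_real pi"
  let ?h = "\<lambda>z. Gamma z * Gamma (1 - z) * sin (?p * z)"
  have ni: "z \<notin> \<int>\<^sub>\<le>\<^sub>0" "1 - z \<notin> \<int>\<^sub>\<le>\<^sub>0" if "Im z > 0" for z :: complex
    using upper_half_plane_not_Ints[OF that] nonpos_Ints_Int by blast+
  have s: "sin (?p * z) \<noteq> 0" if "Im z > 0" for z
    using that unfolding sin_eq_0 by (auto simp: complex_eq_iff)
  have h: "?h z = ?p" if "Im z > 0" for z
    using s[OF that] by (simp add: Gamma_reflection_complex)
  have "(?h has_field_derivative (Gamma \<tau> * Gamma (1 - \<tau>)) *
      ((Digamma \<tau> - Digamma (1 - \<tau>)) * sin (?p * \<tau>) + ?p * cos (?p * \<tau>))) (at \<tau>)"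
    using ni[OF \<tau>] by (auto intro!: derivative_eq_intros simp: algebra_simps)
  moreover have "(?h has_field_derivative 0) (at \<tau>)"
  proof (rule DERIV_cong_ev[THEN iffD2, OF refl _ refl])
    have "open {z. Im z > 0}" by (rule open_halfspace_Im_gt)
    then have "eventually (\<lambda>z. Im z > 0) (nhds \<tau>)" using \<tau> by (simp add: eventually_nhds) blast
    then show "eventually (\<lambda>z. ?h z = ?p) (nhds \<tau>)" by eventually_elim (rule h)
  qed auto
  ultimately have "(Gamma \<tau> * Gamma (1 - \<tau>)) *
      ((Digamma \<tau> - Digamma (1 - \<tau>)) * sin (?p * \<tau>) + ?p * cos (?p * \<tau>)) = 0"
    by (rule DERIV_unique)
  moreover have "Gamma \<tau> \<noteq> 0" "Gamma (1 - \<tau>) \<noteq> 0" using ni[OF \<tau>] by (auto simp: Gamma_eq_zero_iff)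
  ultimately have "(Digamma \<tau> - Digamma (1 - \<tau>)) * sin (?p * \<tau>) + ?p * cos (?p * \<tau>) = 0"
    by simp
  then have "(Digamma (1 - \<tau>) - Digamma \<tau>) * sin (?p * \<tau>) = ?p * cos (?p * \<tau>)"
    by (simp add: algebra_simps)
  then show ?thesis using s[OF \<tau>] by (simp add: cot_def field_simps)
qed

lemma polylog_neg_0: "norm u < 1 \<Longrightarrow> polylog_neg 0 u = 1 / (1 - u)"
  by (simp add: polylog_neg_def suminf_geometric)

lemma DERIV_polylog_neg:
  assumes "norm u < 1" "u \<noteq> 0"
  shows "(polylog_neg n has_field_derivative polylog_neg (Suc n) u / u) (at u)"
proof -
  obtain K where K: "norm u < K" "K < 1" using assms(1) dense by blast
  then have "K > 0" using norm_ge_zero[of u] by linarith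
  have "((\<lambda>u. \<Sum>d. of_nat d ^ n * u ^ d) has_field_derivative (\<Sum>d. diffs (\<lambda>d. of_nat d ^ n) d * u ^ d)) (at u)"
    by (rule termdiffs_strong[of _ "of_real K"])
       (use K \<open>K > 0\<close> in \<open>auto intro!: summable_norm_cancel[OF norm_summable_powser_power]\<close>)
  moreover have "(\<lambda>d. of_nat (Suc d) ^ Suc n * u ^ Suc d) sums polylog_neg (Suc n) u"
    using polylog_neg_sums[OF assms(1), of "Suc n"] by (subst sums_Suc_iff) simp
  then have "(\<lambda>d. of_nat (Suc d) ^ Suc n * u ^ Suc d / u) sums (polylog_neg (Suc n) u / u)"
    by (rule sums_divide)
  then have "(\<lambda>d. diffs (\<lambda>d. of_nat d ^ n) d * u ^ d) sums (polylog_neg (Suc n) u / u)"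
    using assms(2) by (simp add: diffs_def mult.assoc del: of_nat_Suc)
  ultimately show ?thesis
    unfolding polylog_neg_def[abs_def] by (simp add: sums_iff polylog_neg_def)
qed

text \<open>
  Induction on \<open>k\<close> by differentiating in \<open>\<tau>\<close>. The case \<open>k = 0\<close> is the expansion of \<open>\<pi> cot \<pi>\<tau>\<close> in powers of
  the nome; its additive constant \<open>\<pi>i\<close> disappears after one differentiation.
\<close>

lemma Polygamma_reflection:
  assumes "Im \<tau> > 0"
  shows "(-1) ^ Suc k * Polygamma k \<tau> + Polygamma k (1 - \<tau>) =
         (- 2 * of_real pi * \<i>) ^ Suc k * polylog_neg k (nome \<tau>) + (if k = 0 then of_real pi * \<i> else 0)"
  using assms
proof (induction k arbitrary: \<tau>)
  case 0
  let ?e = "exp (of_real pi * \<i> * \<tau>)"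
  have q: "nome \<tau> = ?e * ?e" by (simp add: nome_def mult_ac flip: exp_add)
  have "nome \<tau> \<noteq> 1" using norm_nome_less_1[OF 0] by auto
  then have ee: "?e * ?e \<noteq> 1" by (simp add: q)
  define x y where "x = ?e + inverse ?e" and "y = ?e - inverse ?e"
  have "cot (of_real pi * \<tau>) = (x / 2) / (y / (2 * \<i>))"
    unfolding x_def y_def by (simp add: cot_def sin_exp_eq cos_exp_eq exp_minus mult_ac)
  also have "\<dots> = \<i> * x / y" by (cases "y = 0") (simp_all add: field_simps)
  also have "\<dots> = \<i> * (?e + inverse ?e) / (?e - inverse ?e)" by (simp only: x_def y_def)
  also have "\<dots> = \<i> * (?e * ?e + 1) / (?e * ?e - 1)"
  proof -
    have "?e - inverse ?e \<noteq> 0" using ee by (auto simp: field_simps)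
    then show ?thesis using ee by (simp add: field_simps)
  qed
  finally have "of_real pi * cot (of_real pi * \<tau>) = - 2 * of_real pi * \<i> * (1 / (1 - nome \<tau>)) + of_real pi * \<i>"
    using ee by (simp add: q field_simps)
  then show ?case
    using Digamma_reflection[OF 0] norm_nome_less_1[OF 0] by (simp add: polylog_neg_0)
next
  case (Suc k)
  let ?L = "\<lambda>z. (-1) ^ Suc k * Polygamma k z + Polygamma k (1 - z)"
  let ?R = "\<lambda>z. (- 2 * of_real pi * \<i>) ^ Suc k * polylog_neg k (nome z) + (if k = 0 then of_real pi * \<i> else 0)"
  have ni: "\<tau> \<notin> \<int>\<^sub>\<le>\<^sub>0" "1 - \<tau> \<notin> \<int>\<^sub>\<le>\<^sub>0"
    using upper_half_plane_not_Ints[OF Suc.prems] nonpos_Ints_Int by blast+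
  have L: "(?L has_field_derivative (-1) ^ Suc k * Polygamma (Suc k) \<tau> - Polygamma (Suc k) (1 - \<tau>)) (at \<tau>)"
    by (rule derivative_eq_intros refl DERIV_chain2[OF has_field_derivative_Polygamma] ni)+ simp
  have "(nome has_field_derivative 2 * of_real pi * \<i> * nome \<tau>) (at \<tau>)"
    unfolding nome_def[abs_def] by (auto intro!: derivative_eq_intros)
  then have "((\<lambda>z. polylog_neg k (nome z)) has_field_derivative
      polylog_neg (Suc k) (nome \<tau>) / nome \<tau> * (2 * of_real pi * \<i> * nome \<tau>)) (at \<tau>)"
    by (rule DERIV_chain2[rotated], intro DERIV_polylog_neg norm_nome_less_1 Suc.prems) (simp add: nome_def)
  then have "((\<lambda>z. polylog_neg k (nome z)) has_field_derivative
      polylog_neg (Suc k) (nome \<tau>) * (2 * of_real pi * \<i>)) (at \<tau>)"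
    by (simp add: nome_def mult.assoc)
  then have R: "(?R has_field_derivative
      (- 2 * of_real pi * \<i>) ^ Suc k * (polylog_neg (Suc k) (nome \<tau>) * (2 * of_real pi * \<i>)) + 0) (at \<tau>)"
    by (intro DERIV_add DERIV_cmult) auto
  have "(?L has_field_derivative
      (- 2 * of_real pi * \<i>) ^ Suc k * (polylog_neg (Suc k) (nome \<tau>) * (2 * of_real pi * \<i>)) + 0) (at \<tau>)"
  proof (rule DERIV_cong_ev[THEN iffD2, OF refl _ refl R])
    have "open {z. Im z > 0}" by (rule open_halfspace_Im_gt)
    then have "eventually (\<lambda>z. Im z > 0) (nhds \<tau>)" using Suc.prems by (simp add: eventually_nhds) blast
    then show "eventually (\<lambda>z. ?L z = ?R z) (nhds \<tau>)" by eventually_elim (rule Suc.IH)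
  qed
  note deriv_eq = DERIV_unique[OF L this]
  have eqI: "x = y" if "x - y = v - u" "u = v" for x y u v :: complex
    using that by simp
  show ?case
    by (rule eqI[OF _ deriv_eq]) (simp add: algebra_simps)
qed

definition lipschitz_const :: "nat \<Rightarrow> complex" where
  "lipschitz_const k = (- 2 * of_real pi * \<i>) ^ k / fact (k - 1)"

lemma lipschitz_const_nonzero: "lipschitz_const k \<noteq> 0"
  by (simp add: lipschitz_const_def)

lemma Lipschitz_formula:
  assumes "Im \<tau> > 0" "k \<ge> 2"
  shows "row_sum k \<tau> = lipschitz_const k * polylog_neg (k - 1) (nome \<tau>)"
proof -
  obtain j where j: "k = Suc j" "j > 0" using assms(2) by (cases k) auto
  show ?thesis
    using row_sum_Polygamma[OF assms(1) j(2)] Polygamma_reflection[OF assms(1), of j] j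
    by (simp add: lipschitz_const_def)
qed

section \<open>Regularised Eisenstein series\<close>

(* Frees the dollar sign for matrix entries. *)
unbundle no fps_syntax

definition lattice_recip :: "nat \<Rightarrow> complex \<Rightarrow> int \<Rightarrow> int \<Rightarrow> complex" where
  "lattice_recip k z m n = 1 / lattice_point z m n ^ k"

text \<open>
  For \<open>k \<ge> 3\<close> these are the terms of the Eisenstein series over the coset \<open>(r, s) + N\<int>\<^sup>2\<close>. For \<open>k = 2\<close> the
  term of the same index in \<open>N\<int>\<^sup>2\<close> is subtracted, as in the \<open>\<wp>\<close>-function. The convention \<open>1 / 0 = 0\<close>
  omits the point \<open>(0, 0)\<close> from both sums, so that the formula is also the right one for the class of \<open>(0, 0)\<close>.
\<close>

definition eisenstein_term :: "nat \<Rightarrow> nat \<Rightarrow> int \<Rightarrow> int \<Rightarrow> complex \<Rightarrow> int \<times> int \<Rightarrow> complex" where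
  "eisenstein_term k N r s z = (\<lambda>(a, b).
     lattice_recip k z (int N * a + r) (int N * b + s) -
     of_bool (k = 2) * lattice_recip k z (int N * a) (int N * b))"

definition eisenstein :: "nat \<Rightarrow> nat \<Rightarrow> int \<Rightarrow> int \<Rightarrow> complex \<Rightarrow> complex" where
  "eisenstein k N r s z = (\<Sum>\<^sub>\<infinity>x\<in>UNIV. eisenstein_term k N r s z x)"

lemma lattice_coset_bound:
  assumes "N > 0"
  shows "1 + \<bar>real_of_int a\<bar> + \<bar>real_of_int b\<bar> \<le>
    1 + \<bar>real_of_int (int N * a + r)\<bar> + \<bar>real_of_int (int N * b + s)\<bar> + \<bar>real_of_int r\<bar> + \<bar>real_of_int s\<bar>"
proof -
  have "\<bar>real_of_int x\<bar> \<le> \<bar>real_of_int (int N * x + t)\<bar> + \<bar>real_of_int t\<bar>" for x t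
  proof -
    have "1 * \<bar>x\<bar> \<le> int N * \<bar>x\<bar>" using assms by (intro mult_right_mono) auto
    also have "\<dots> = \<bar>int N * x\<bar>" by (simp add: abs_mult)
    also have "\<dots> \<le> \<bar>int N * x + t\<bar> + \<bar>t\<bar>" by linarith
    finally have "\<bar>x\<bar> \<le> \<bar>int N * x + t\<bar> + \<bar>t\<bar>" by simp
    then have "real_of_int \<bar>x\<bar> \<le> real_of_int (\<bar>int N * x + t\<bar> + \<bar>t\<bar>)" by (simp only: of_int_le_iff)
    then show ?thesis by simp
  qed
  from this[of a r] this[of b s] show ?thesis by simp
qed

lemma lattice_recip_coset_bound:
  assumes "N > 0" "y > 0" "R \<ge> 0"
  obtains B where "B \<ge> 1"
    "\<And>z a b. Im z \<ge> y \<Longrightarrow> \<bar>Re z\<bar> \<le> R \<Longrightarrow>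
       norm (lattice_recip 1 z (int N * a + r) (int N * b + s)) \<le> B / (1 + \<bar>real_of_int a\<bar> + \<bar>real_of_int b\<bar>)"
proof
  define K where "K = 1 + (1 + R) / y"
  define D where "D = 2 + \<bar>real_of_int r\<bar> + \<bar>real_of_int s\<bar>"
  have K: "K \<ge> 1" using assms by (simp add: K_def)
  have D: "D \<ge> 1" by (simp add: D_def)
  show "K * D \<ge> 1" using mult_mono[OF K D] K by simp
  fix z a b assume z: "Im z \<ge> y" "\<bar>Re z\<bar> \<le> R"
  let ?m = "int N * a + r" and ?n = "int N * b + s"
  define w where "w = 1 + \<bar>real_of_int a\<bar> + \<bar>real_of_int b\<bar>"
  have w: "w \<ge> 1" by (simp add: w_def)
  show "norm (lattice_recip 1 z ?m ?n) \<le> K * D / (1 + \<bar>real_of_int a\<bar> + \<bar>real_of_int b\<bar>)"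
  proof (cases "?m = 0 \<and> ?n = 0")
    case True
    then show ?thesis using K D by (simp add: lattice_recip_def lattice_point_def)
  next
    case False
    let ?t = "\<bar>real_of_int ?m\<bar> + \<bar>real_of_int ?n\<bar>"
    have "\<bar>?m\<bar> + \<bar>?n\<bar> \<ge> 1" using False by linarith
    then have "real_of_int (\<bar>?m\<bar> + \<bar>?n\<bar>) \<ge> 1" by linarith
    then have t: "?t \<ge> 1" by simp
    have "w \<le> 1 + ?t + (\<bar>real_of_int r\<bar> + \<bar>real_of_int s\<bar>)"
      using lattice_coset_bound[OF assms(1), of a b r s] by (simp add: w_def)
    also have "\<dots> \<le> ?t + ?t + (\<bar>real_of_int r\<bar> + \<bar>real_of_int s\<bar>) * ?t"
      using t mult_left_mono[OF t, of "\<bar>real_of_int r\<bar> + \<bar>real_of_int s\<bar>"] by simp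
    also have "\<dots> = D * ?t" by (simp add: D_def algebra_simps)
    also have "\<dots> \<le> D * (K * norm (lattice_point z ?m ?n))"
      using D lattice_point_bound[OF z(1) assms(2) z(2), of ?m ?n] unfolding K_def
      by (intro mult_left_mono) auto
    finally have wl: "w \<le> K * D * norm (lattice_point z ?m ?n)" by (simp add: mult_ac)
    have "lattice_point z ?m ?n \<noteq> 0"
      using lattice_point_eq_0_iff[of z ?m ?n] False z assms by auto
    then have "norm (lattice_point z ?m ?n) > 0" by simp
    then have "1 / norm (lattice_point z ?m ?n) \<le> K * D / w"
      using wl w by (simp add: field_simps)
    then show ?thesis by (simp add: lattice_recip_def norm_divide w_def)
  qed
qed

lemma lattice_recip_power: "lattice_recip k z m n = lattice_recip 1 z m n ^ k"
  by (simp add: lattice_recip_def power_one_over)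

text \<open>
  For \<open>k \<ge> 3\<close> the reciprocal of a lattice point to the power \<open>k\<close> decays fast enough. For \<open>k = 2\<close>, writing
  \<open>u\<close> and \<open>v\<close> for the two reciprocals, \<open>u\<^sup>2 - v\<^sup>2 = (u - v)(u + v)\<close> and \<open>u - v = - (rz + s) u v\<close>, which
  gains one order of decay at the price of the factor \<open>1 + |z|\<close>. A bound that grows linearly in \<open>z\<close> is
  harmless at the cusps, see \<open>holomorphic_at_infinity_of_growth\<close>.
\<close>

lemma eisenstein_term_bound:
  assumes "N > 0" "k \<ge> 2" "y > 0" "R \<ge> 0"
  obtains C where "C \<ge> 0"
    "\<And>z a b. Im z \<ge> y \<Longrightarrow> \<bar>Re z\<bar> \<le> R \<Longrightarrow>
       norm (eisenstein_term k N r s z (a, b)) \<le> C * (1 + norm z) * (1 / (1 + \<bar>real_of_int a\<bar> + \<bar>real_of_int b\<bar>) ^ 3)"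
proof -
  obtain B1 where B1: "B1 \<ge> 1"
    "\<And>z a b. Im z \<ge> y \<Longrightarrow> \<bar>Re z\<bar> \<le> R \<Longrightarrow>
       norm (lattice_recip 1 z (int N * a + r) (int N * b + s)) \<le> B1 / (1 + \<bar>real_of_int a\<bar> + \<bar>real_of_int b\<bar>)"
    using lattice_recip_coset_bound[OF assms(1,3,4), of r s] by blast
  obtain B0 where B0: "B0 \<ge> 1"
    "\<And>z a b. Im z \<ge> y \<Longrightarrow> \<bar>Re z\<bar> \<le> R \<Longrightarrow>
       norm (lattice_recip 1 z (int N * a + 0) (int N * b + 0)) \<le> B0 / (1 + \<bar>real_of_int a\<bar> + \<bar>real_of_int b\<bar>)"
    using lattice_recip_coset_bound[OF assms(1,3,4), of 0 0] by blast
  define B where "B = max B0 B1"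
  define D where "D = 2 + \<bar>real_of_int r\<bar> + \<bar>real_of_int s\<bar>"
  have B: "B \<ge> 1" and D: "D \<ge> 1" using B1 by (auto simp: B_def D_def)
  show thesis
  proof
    show "B ^ k + 4 * D * B ^ 3 \<ge> 0" using B D by simp
    fix z a b assume z: "Im z \<ge> y" "\<bar>Re z\<bar> \<le> R"
    define w where "w = 1 + \<bar>real_of_int a\<bar> + \<bar>real_of_int b\<bar>"
    have w: "w \<ge> 1" by (simp add: w_def)
    define u where "u = lattice_recip 1 z (int N * a + r) (int N * b + s)"
    define v where "v = lattice_recip 1 z (int N * a) (int N * b)"
    have u: "norm u \<le> B / w"
      unfolding u_def
      by (rule order_trans[OF B1(2)[OF z]]) (auto simp: B_def w_def intro!: divide_right_mono)
    have "norm v \<le> B0 / w"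
      using B0(2)[OF z, of a b] by (simp add: v_def w_def)
    also have "\<dots> \<le> B / w" using w by (intro divide_right_mono) (auto simp: B_def)
    finally have v: "norm v \<le> B / w" .
    have term_eq: "eisenstein_term k N r s z (a, b) = u ^ k - of_bool (k = 2) * v ^ k"
      unfolding eisenstein_term_def u_def v_def by (simp add: lattice_recip_power[of k])
    have "norm (eisenstein_term k N r s z (a, b)) \<le> (B ^ k + 4 * D * B ^ 3) * (1 + norm z) * (1 / w ^ 3)"
    proof (cases "k = 2")
      case False
      have "norm (u ^ k) \<le> (B / w) ^ k" unfolding norm_power by (intro power_mono u) auto
      also have "\<dots> = B ^ k * (1 / w ^ k)" by (simp add: power_divide)
      also have "\<dots> \<le> B ^ k * (1 / w ^ 3)"
        using w B False assms(2) by (intro mult_left_mono divide_left_mono power_increasing) auto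
      also have "\<dots> = B ^ k * 1 * (1 / w ^ 3)" by simp
      also have "\<dots> \<le> (B ^ k + 4 * D * B ^ 3) * (1 + norm z) * (1 / w ^ 3)"
        using B D w by (intro mult_mono) auto
      finally show ?thesis using False by (simp add: term_eq)
    next
      case True
      have uv: "norm (u + v) \<le> 2 * (B / w)"
        using norm_triangle_ineq[of u v] u v by simp
      have diff: "norm (u - v) \<le> 2 * D * B\<^sup>2 * (1 + norm z) / w\<^sup>2"
      \<comment> \<open>If one of the two points is the origin, then \<open>w\<close> is bounded by \<open>D\<close> and decay is no issue.\<close>
      proof (cases "(a = 0 \<and> b = 0) \<or> (int N * a + r = 0 \<and> int N * b + s = 0)")
        case True
        have wD: "w \<le> D"
        proof (cases "a = 0 \<and> b = 0")
          case False
          with True have "int N * a + r = 0" "int N * b + s = 0" by auto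
          with lattice_coset_bound[OF assms(1), of a b r s] show ?thesis
            by (simp only: of_int_0) (simp add: w_def D_def)
        qed (simp add: w_def D_def)
        have "norm (u - v) \<le> 2 * (B / w)"
          using norm_triangle_ineq4[of u v] u v by simp
        also have "\<dots> = 2 * B * w / w\<^sup>2" using w by (simp add: field_simps power2_eq_square)
        also have "\<dots> \<le> 2 * B\<^sup>2 * D / w\<^sup>2"
          using w wD B by (intro divide_right_mono mult_mono) (auto simp: power2_eq_square)
        also have "\<dots> = (2 * D * B\<^sup>2) * 1 / w\<^sup>2" by simp
        also have "\<dots> \<le> 2 * D * B\<^sup>2 * (1 + norm z) / w\<^sup>2"
          using w B D by (intro divide_right_mono mult_left_mono) auto
        finally show ?thesis .
      next
        case False
        let ?l = "lattice_point z (int N * a + r) (int N * b + s)" and ?l' = "lattice_point z (int N * a) (int N * b)"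
        have "?l \<noteq> 0" "?l' \<noteq> 0"
          using lattice_point_eq_0_iff[of z] False z assms by (auto simp del: of_int_add of_int_mult)
        then have "u - v = (?l' - ?l) * (u * v)"
          by (simp add: u_def v_def lattice_recip_def field_simps)
        also have "?l' - ?l = - lattice_point z r s" by (simp add: lattice_point_def algebra_simps)
        finally have "norm (u - v) = norm (lattice_point z r s) * (norm u * norm v)"
          by (simp add: norm_mult)
        also have "norm (lattice_point z r s) \<le> norm (of_int r * z) + norm (of_int s :: complex)"
          unfolding lattice_point_def by (rule norm_triangle_ineq)
        also have "\<dots> = \<bar>real_of_int r\<bar> * norm z + \<bar>real_of_int s\<bar>" by (simp add: norm_mult)
        also have "\<dots> \<le> 2 * D * (1 + norm z)"
          by (simp add: D_def algebra_simps add_nonneg_nonneg)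
        finally have "norm (u - v) \<le> 2 * D * (1 + norm z) * (norm u * norm v)"
          by (simp add: mult_right_mono)
        also have "\<dots> \<le> 2 * D * (1 + norm z) * ((B / w) * (B / w))"
          using u v B w D by (intro mult_left_mono mult_mono) auto
        also have "\<dots> = 2 * D * B\<^sup>2 * (1 + norm z) / w\<^sup>2" by (simp add: power2_eq_square)
        finally show ?thesis .
      qed
      have "u ^ 2 - v ^ 2 = (u - v) * (u + v)" by (simp add: power2_eq_square algebra_simps)
      then have "norm (u ^ 2 - v ^ 2) = norm (u - v) * norm (u + v)" by (simp add: norm_mult)
      also have "\<dots> \<le> (2 * D * B\<^sup>2 * (1 + norm z) / w\<^sup>2) * (2 * (B / w))"
        using diff uv B D w by (intro mult_mono) auto
      also have "\<dots> = (4 * D * B ^ 3) * (1 + norm z) * (1 / w ^ 3)"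
        using w by (simp add: field_simps power2_eq_square power3_eq_cube)
      also have "\<dots> \<le> (B ^ k + 4 * D * B ^ 3) * (1 + norm z) * (1 / w ^ 3)"
        using B D w by (intro mult_right_mono) auto
      finally show ?thesis unfolding term_eq using True by simp
    qed
    then show "norm (eisenstein_term k N r s z (a, b)) \<le>
        (B ^ k + 4 * D * B ^ 3) * (1 + norm z) * (1 / (1 + \<bar>real_of_int a\<bar> + \<bar>real_of_int b\<bar>) ^ 3)"
      by (simp add: w_def)
  qed
qed

lemma eisenstein_term_abs_summable:
  assumes "N > 0" "k \<ge> 2" "Im z > 0"
  shows "(\<lambda>x. norm (eisenstein_term k N r s z x)) summable_on UNIV"
proof -
  obtain C where C: "C \<ge> 0" "\<And>z' a b. Im z' \<ge> Im z \<Longrightarrow> \<bar>Re z'\<bar> \<le> \<bar>Re z\<bar> \<Longrightarrow>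
       norm (eisenstein_term k N r s z' (a, b)) \<le> C * (1 + norm z') * (1 / (1 + \<bar>real_of_int a\<bar> + \<bar>real_of_int b\<bar>) ^ 3)"
    using eisenstein_term_bound[OF assms, of "\<bar>Re z\<bar>" r s] by auto
  show ?thesis
    by (rule Infinite_Sum.abs_summable_on_comparison_test'[OF summable_on_cmult_right[OF summable_on_lattice_cubes, of "C * (1 + norm z)"]])
       (use C(2)[of z] in auto)
qed

lemma eisenstein_has_sum:
  assumes "N > 0" "k \<ge> 2" "Im z > 0"
  shows "(eisenstein_term k N r s z has_sum eisenstein k N r s z) UNIV"
  unfolding eisenstein_def
  by (rule has_sum_infsum, rule abs_summable_summable, rule eisenstein_term_abs_summable[OF assms])

lemma eisenstein_linear_growth:
  assumes "N > 0" "k \<ge> 2" "R \<ge> 0"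
  obtains C where "\<And>z. Im z \<ge> 1 \<Longrightarrow> \<bar>Re z\<bar> \<le> R \<Longrightarrow> norm (eisenstein k N r s z) \<le> C * (1 + norm z)"
proof -
  obtain C where C: "C \<ge> 0" "\<And>z a b. Im z \<ge> 1 \<Longrightarrow> \<bar>Re z\<bar> \<le> R \<Longrightarrow>
       norm (eisenstein_term k N r s z (a, b)) \<le> C * (1 + norm z) * (1 / (1 + \<bar>real_of_int a\<bar> + \<bar>real_of_int b\<bar>) ^ 3)"
    using eisenstein_term_bound[OF assms(1,2) zero_less_one assms(3), of r s] by auto
  let ?c = "\<lambda>(a, b). 1 / (1 + \<bar>real_of_int a\<bar> + \<bar>real_of_int b\<bar>) ^ 3"
  show thesis
  proof
    fix z assume z: "Im z \<ge> 1" "\<bar>Re z\<bar> \<le> R"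
    have "norm (eisenstein k N r s z) \<le> C * (1 + norm z) * infsum ?c UNIV"
    proof (rule norm_infsum_le)
      show "(eisenstein_term k N r s z has_sum eisenstein k N r s z) UNIV"
        using z by (intro eisenstein_has_sum assms) auto
      show "((\<lambda>x. C * (1 + norm z) * ?c x) has_sum C * (1 + norm z) * infsum ?c UNIV) UNIV"
        by (intro has_sum_cmult_right has_sum_infsum summable_on_lattice_cubes)
    qed (use C(2)[OF z] in auto)
    then show "norm (eisenstein k N r s z) \<le> (C * infsum ?c UNIV) * (1 + norm z)"
      by (simp add: mult_ac)
  qed
qed

lemma eisenstein_term_holomorphic:
  "(\<lambda>z. eisenstein_term k N r s z x) holomorphic_on upper_half_plane"
proof -
  have h: "(\<lambda>z. lattice_recip k z m n) holomorphic_on upper_half_plane" for k m n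
  proof (cases "m = 0 \<and> n = 0")
    case False
    then have "\<And>z. z \<in> upper_half_plane \<Longrightarrow> lattice_point z m n \<noteq> 0"
      by (auto simp: upper_half_plane_def lattice_point_eq_0_iff)
    then show ?thesis
      unfolding lattice_recip_def lattice_point_def by (intro holomorphic_intros) auto
  qed (simp add: lattice_recip_def lattice_point_def)
  show ?thesis
    unfolding eisenstein_term_def by (cases x) (auto intro!: holomorphic_intros h)
qed

lemma eisenstein_holomorphic:
  assumes "N > 0" "k \<ge> 2"
  shows "eisenstein k N r s holomorphic_on upper_half_plane"
proof (rule holomorphic_onI)
  fix z0 assume "z0 \<in> upper_half_plane"
  then have z0: "Im z0 > 0" by (simp add: upper_half_plane_def)
  define \<rho> where "\<rho> = Im z0 / 2"
  have \<rho>: "\<rho> > 0" using z0 by (simp add: \<rho>_def)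
  have region: "Im z \<ge> \<rho>" "\<bar>Re z\<bar> \<le> norm z0 + \<rho>" "norm z \<le> norm z0 + \<rho>" if "z \<in> cball z0 \<rho>" for z
  proof -
    have d: "norm (z - z0) \<le> \<rho>" using that by (simp add: dist_norm norm_minus_commute)
    show "Im z \<ge> \<rho>" using abs_Im_le_cmod[of "z - z0"] d by (simp add: \<rho>_def)
    show "norm z \<le> norm z0 + \<rho>" using norm_triangle_ineq[of "z - z0" z0] d by simp
    then show "\<bar>Re z\<bar> \<le> norm z0 + \<rho>" using abs_Re_le_cmod[of z] by simp
  qed
  have sub: "cball z0 \<rho> \<subseteq> upper_half_plane"
    using region(1) \<rho> by (force simp: upper_half_plane_def)
  have "norm z0 + \<rho> \<ge> 0" using \<rho> by simp
  then obtain C where C: "C \<ge> 0" "\<And>z a b. Im z \<ge> \<rho> \<Longrightarrow> \<bar>Re z\<bar> \<le> norm z0 + \<rho> \<Longrightarrow>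
       norm (eisenstein_term k N r s z (a, b)) \<le> C * (1 + norm z) * (1 / (1 + \<bar>real_of_int a\<bar> + \<bar>real_of_int b\<bar>) ^ 3)"
    using eisenstein_term_bound[OF assms \<rho>, of "norm z0 + \<rho>" r s] by auto
  let ?c = "\<lambda>(a, b). 1 / (1 + \<bar>real_of_int a\<bar> + \<bar>real_of_int b\<bar>) ^ 3"
  have "uniform_limit (cball z0 \<rho>) (\<lambda>X z. \<Sum>x\<in>X. eisenstein_term k N r s z x)
          (\<lambda>z. \<Sum>\<^sub>\<infinity>x\<in>UNIV. eisenstein_term k N r s z x) (finite_subsets_at_top UNIV)"
  proof (rule Weierstrass_m_test_general)
    show "(\<lambda>x. C * (1 + (norm z0 + \<rho>)) * ?c x) summable_on UNIV"
      by (intro summable_on_cmult_right summable_on_lattice_cubes)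
    fix x :: "int \<times> int" and z assume z: "z \<in> cball z0 \<rho>"
    obtain a b where x: "x = (a, b)" by (cases x)
    show "norm (eisenstein_term k N r s z x) \<le> C * (1 + (norm z0 + \<rho>)) * ?c x"
      unfolding x using C region[OF z] \<rho>
      by (intro order_trans[OF C(2)]) (auto intro!: mult_right_mono mult_left_mono divide_right_mono)
  qed
  then have lim: "uniform_limit (cball z0 \<rho>) (\<lambda>X z. \<Sum>x\<in>X. eisenstein_term k N r s z x)
          (eisenstein k N r s) (finite_subsets_at_top UNIV)"
    by (simp add: eisenstein_def[abs_def])
  have "(\<lambda>z. \<Sum>x\<in>X. eisenstein_term k N r s z x) holomorphic_on upper_half_plane" for X
    by (intro holomorphic_intros eisenstein_term_holomorphic)
  then have "continuous_on (cball z0 \<rho>) (\<lambda>z. \<Sum>x\<in>X. eisenstein_term k N r s z x) \<and>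
      (\<lambda>z. \<Sum>x\<in>X. eisenstein_term k N r s z x) holomorphic_on ball z0 \<rho>" for X
    using sub ball_subset_cball[of z0 \<rho>]
    by (meson holomorphic_on_imp_continuous_on holomorphic_on_subset order_trans)
  then have "eisenstein k N r s holomorphic_on ball z0 \<rho>"
    by - (rule holomorphic_uniform_limit[OF _ lim], auto)
  then show "eisenstein k N r s field_differentiable at z0 within upper_half_plane"
    using \<rho> by - (rule field_differentiable_at_within[OF holomorphic_on_imp_differentiable_at[OF _ open_ball]], auto)
qed

section \<open>Dependence on the class modulo N\<close>

lemma has_sum_telescope_int:
  fixes f :: "int \<Rightarrow> complex"
  assumes "f summable_on UNIV"
  shows "((\<lambda>a. f (a + 1) - f a) has_sum 0) UNIV"
proof -
  have "((\<lambda>a. f (a + 1)) has_sum infsum f UNIV) UNIV \<longleftrightarrow> (f has_sum infsum f UNIV) UNIV"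
    by (rule has_sum_reindex_bij_witness[of _ "\<lambda>a. a - 1" "\<lambda>a. a + 1"]) auto
  then have "((\<lambda>a. f (a + 1)) has_sum infsum f UNIV) UNIV"
    using assms by auto
  then have "((\<lambda>a. f (a + 1) + - f a) has_sum (infsum f UNIV + - infsum f UNIV)) UNIV"
    by (intro has_sum_add has_sum_uminusI has_sum_infsum assms)
  then show ?thesis by simp
qed

lemma lattice_recip_coset_summable:
  assumes "N > 0" "k \<ge> 2" "Im z > 0"
  shows "(\<lambda>a. lattice_recip k z (int N * a + r) (int N * b + s)) summable_on UNIV"
    and "(\<lambda>b. lattice_recip k z (int N * a + r) (int N * b + s)) summable_on UNIV"
proof -
  obtain B where B: "B \<ge> 1"
    "\<And>z' a b. Im z' \<ge> Im z \<Longrightarrow> \<bar>Re z'\<bar> \<le> \<bar>Re z\<bar> \<Longrightarrow>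
       norm (lattice_recip 1 z' (int N * a + r) (int N * b + s)) \<le> B / (1 + \<bar>real_of_int a\<bar> + \<bar>real_of_int b\<bar>)"
    using lattice_recip_coset_bound[OF assms(1,3), of "\<bar>Re z\<bar>" r s] by auto
  have bound: "norm (lattice_recip k z (int N * a + r) (int N * b + s)) \<le> B ^ k * (1 + \<bar>real_of_int t\<bar>) powr (-2)"
    if "t = a \<or> t = b" for t a b
  proof -
    define w where "w = 1 + \<bar>real_of_int t\<bar>"
    have w: "w \<ge> 1" by (simp add: w_def)
    have "norm (lattice_recip 1 z (int N * a + r) (int N * b + s)) \<le> B / (1 + \<bar>real_of_int a\<bar> + \<bar>real_of_int b\<bar>)"
      by (rule B(2)) auto
    also have "\<dots> \<le> B / w"
      using that B(1) by (intro divide_left_mono) (auto simp: w_def)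
    finally have "norm (lattice_recip k z (int N * a + r) (int N * b + s)) \<le> (B / w) ^ k"
      unfolding lattice_recip_power[of k] norm_power by (intro power_mono) auto
    also have "\<dots> = B ^ k * (1 / w ^ k)" by (simp add: power_divide)
    also have "\<dots> \<le> B ^ k * (1 / w ^ 2)"
      using B(1) w assms(2) by (intro mult_left_mono divide_left_mono power_increasing) auto
    also have "1 / w ^ 2 = w powr (- 2)"
      using w by (simp add: powr_minus powr_numeral inverse_eq_divide)
    finally show ?thesis by (simp add: w_def)
  qed
  have s: "(\<lambda>t. B ^ k * (1 + \<bar>real_of_int t\<bar>) powr (-2)) summable_on UNIV"
    by (intro summable_on_cmult_right summable_on_int_powr) simp
  show "(\<lambda>a. lattice_recip k z (int N * a + r) (int N * b + s)) summable_on UNIV"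
    by (rule abs_summable_summable, rule Infinite_Sum.abs_summable_on_comparison_test'[OF s], rule bound) simp
  show "(\<lambda>b. lattice_recip k z (int N * a + r) (int N * b + s)) summable_on UNIV"
    by (rule abs_summable_summable, rule Infinite_Sum.abs_summable_on_comparison_test'[OF s], rule bound) simp
qed

text \<open>
  The counterpart of the double periodicity of \<open>\<wp>\<close>. In the difference of the two series the subtracted
  terms cancel, and it remains \<open>\<Sum> (h(a+1, b) - h(a, b))\<close>. This double series converges absolutely,
  although \<open>\<Sum> h(a, b)\<close> need not, so it may be summed over \<open>a\<close> first, where it telescopes to \<open>0\<close> because
  \<open>\<Sum>\<^sub>a h(a, b)\<close> does converge.
\<close>

lemma eisenstein_shift:
  assumes "N > 0" "k \<ge> 2" "Im z > 0"
  shows "eisenstein k N (r + int N) s z = eisenstein k N r s z"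
    and "eisenstein k N r (s + int N) z = eisenstein k N r s z"
proof -
  let ?h = "\<lambda>a b. lattice_recip k z (int N * a + r) (int N * b + s)"
  have diff1: "((\<lambda>(a, b). ?h (a + 1) b - ?h a b) has_sum
      eisenstein k N (r + int N) s z + - eisenstein k N r s z) UNIV"
  proof -
    have "((\<lambda>x. eisenstein_term k N (r + int N) s z x + - eisenstein_term k N r s z x) has_sum
        eisenstein k N (r + int N) s z + - eisenstein k N r s z) UNIV"
      by (intro has_sum_add has_sum_uminusI eisenstein_has_sum assms)
    then show ?thesis
      by (rule has_sum_cong[THEN iffD1, rotated])
         (auto simp: eisenstein_term_def algebra_simps)
  qed
  then have "((\<lambda>(b, a). ?h (a + 1) b - ?h a b) has_sum
      eisenstein k N (r + int N) s z + - eisenstein k N r s z) (UNIV \<times> UNIV)"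
    by (subst has_sum_swap) simp
  then have "((\<lambda>b. 0) has_sum eisenstein k N (r + int N) s z + - eisenstein k N r s z) (UNIV :: int set)"
  proof (rule has_sum_SigmaD)
    fix b
    show "((\<lambda>a. case (b, a) of (b, a) \<Rightarrow> ?h (a + 1) b - ?h a b) has_sum 0) UNIV"
      using has_sum_telescope_int[OF lattice_recip_coset_summable(1)[OF assms]] by simp
  qed
  then show "eisenstein k N (r + int N) s z = eisenstein k N r s z"
    using has_sum_unique[OF _ has_sum_0_simp] by fastforce
  have diff2: "((\<lambda>(a, b). ?h a (b + 1) - ?h a b) has_sum
      eisenstein k N r (s + int N) z + - eisenstein k N r s z) (UNIV \<times> UNIV)"
  proof -
    have "((\<lambda>x. eisenstein_term k N r (s + int N) z x + - eisenstein_term k N r s z x) has_sum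
        eisenstein k N r (s + int N) z + - eisenstein k N r s z) UNIV"
      by (intro has_sum_add has_sum_uminusI eisenstein_has_sum assms)
    then show ?thesis
      unfolding UNIV_Times_UNIV
      by (rule has_sum_cong[THEN iffD1, rotated])
         (auto simp: eisenstein_term_def algebra_simps)
  qed
  then have "((\<lambda>a. 0) has_sum eisenstein k N r (s + int N) z + - eisenstein k N r s z) (UNIV :: int set)"
  proof (rule has_sum_SigmaD)
    fix a
    show "((\<lambda>b. case (a, b) of (a, b) \<Rightarrow> ?h a (b + 1) - ?h a b) has_sum 0) UNIV"
      using has_sum_telescope_int[OF lattice_recip_coset_summable(2)[OF assms]] by simp
  qed
  then show "eisenstein k N r (s + int N) z = eisenstein k N r s z"
    using has_sum_unique[OF _ has_sum_0_simp] by fastforce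
qed

lemma periodic_int_mult:
  fixes f :: "int \<Rightarrow> 'a"
  assumes "\<And>x. f (x + p) = f x"
  shows "f (x + p * t) = f x"
proof (induction t rule: int_induct[where k = 0])
  case (step1 i)
  then show ?case using assms[of "x + p * i"] by (simp add: algebra_simps)
next
  case (step2 i)
  then show ?case using assms[of "x + p * (i - 1)"] by (simp add: algebra_simps)
qed simp

lemma eisenstein_cong:
  assumes "N > 0" "k \<ge> 2" "Im z > 0" "[r = r'] (mod int N)" "[s = s'] (mod int N)"
  shows "eisenstein k N r s z = eisenstein k N r' s' z"
proof -
  obtain t u where "r' = r + int N * t" "s' = s + int N * u"
    using assms(4,5) by (metis cong_iff_lin mult.commute)
  then show ?thesis
    using periodic_int_mult[of "\<lambda>r. eisenstein k N r s' z" "int N" r t]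
      periodic_int_mult[of "\<lambda>s. eisenstein k N r s z" "int N" s u]
    by (simp add: eisenstein_shift[OF assms(1-3)])
qed

section \<open>The action of the modular group\<close>

definition moebius :: "int ^ 2 ^ 2 \<Rightarrow> complex \<Rightarrow> complex" where
  "moebius \<gamma> z = lattice_point z (\<gamma> $ 1 $ 1) (\<gamma> $ 1 $ 2) / lattice_point z (\<gamma> $ 2 $ 1) (\<gamma> $ 2 $ 2)"

lemma slash_eq:
  fixes \<gamma> :: "int ^ 2 ^ 2"
  shows "slash k \<gamma> f z = lattice_point z (\<gamma> $ 2 $ 1) (\<gamma> $ 2 $ 2) powi (- k) * f (moebius \<gamma> z)"
  by (simp add: slash_def moebius_def lattice_point_def)

lemma SL2Z_denominator_nonzero:
  fixes \<gamma> :: "int ^ 2 ^ 2"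
  assumes "\<gamma> \<in> SL2Z" "Im z > 0"
  shows "lattice_point z (\<gamma> $ 2 $ 1) (\<gamma> $ 2 $ 2) \<noteq> 0"
  using assms by (auto simp: lattice_point_eq_0_iff SL2Z_def det_2)

lemma Im_moebius:
  fixes \<gamma> :: "int ^ 2 ^ 2"
  assumes "\<gamma> \<in> SL2Z" "Im z > 0"
  shows "Im (moebius \<gamma> z) > 0"
proof -
  let ?l = "lattice_point z (\<gamma> $ 2 $ 1) (\<gamma> $ 2 $ 2)"
  have det: "real_of_int (\<gamma>$1$1) * real_of_int (\<gamma>$2$2) - real_of_int (\<gamma>$1$2) * real_of_int (\<gamma>$2$1) = 1"
  proof -
    have "\<gamma>$1$1 * \<gamma>$2$2 - \<gamma>$1$2 * \<gamma>$2$1 = 1" using assms(1) by (simp add: SL2Z_def det_2)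
    then have "real_of_int (\<gamma>$1$1 * \<gamma>$2$2 - \<gamma>$1$2 * \<gamma>$2$1) = 1" by (simp only: of_int_1)
    then show ?thesis by simp
  qed
  have "Im (lattice_point z (\<gamma> $ 1 $ 1) (\<gamma> $ 1 $ 2) * cnj ?l) =
      (real_of_int (\<gamma>$1$1) * real_of_int (\<gamma>$2$2) - real_of_int (\<gamma>$1$2) * real_of_int (\<gamma>$2$1)) * Im z"
    by (simp add: lattice_point_def algebra_simps)
  then have "Im (lattice_point z (\<gamma> $ 1 $ 1) (\<gamma> $ 1 $ 2) * cnj ?l) = Im z" by (simp only: det mult_1)
  then have "Im (moebius \<gamma> z) = Im z / (cmod ?l)\<^sup>2"
    unfolding moebius_def complex_div_cnj[of "lattice_point z (\<gamma> $ 1 $ 1) (\<gamma> $ 1 $ 2)"]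
    by (simp flip: of_real_power)
  then show ?thesis using assms SL2Z_denominator_nonzero[OF assms] by simp
qed

lemma slash_lattice_recip:
  fixes \<gamma> :: "int ^ 2 ^ 2"
  assumes "\<gamma> \<in> SL2Z" "Im z > 0"
  shows "lattice_point z (\<gamma> $ 2 $ 1) (\<gamma> $ 2 $ 2) powi (- int k) * lattice_recip k (moebius \<gamma> z) m n =
    lattice_recip k z (m * \<gamma>$1$1 + n * \<gamma>$2$1) (m * \<gamma>$1$2 + n * \<gamma>$2$2)"
proof -
  let ?l = "lattice_point z (\<gamma> $ 2 $ 1) (\<gamma> $ 2 $ 2)"
  have l: "?l \<noteq> 0" by (rule SL2Z_denominator_nonzero[OF assms])
  have "?l * lattice_point (moebius \<gamma> z) m n =
      of_int m * lattice_point z (\<gamma>$1$1) (\<gamma>$1$2) + of_int n * ?l"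
    using l by (simp add: moebius_def lattice_point_def[of "_ / _"] distrib_left)
  also have "\<dots> = lattice_point z (m * \<gamma>$1$1 + n * \<gamma>$2$1) (m * \<gamma>$1$2 + n * \<gamma>$2$2)"
    by (simp add: lattice_point_def algebra_simps)
  finally show ?thesis
    by (simp add: lattice_recip_def power_int_minus divide_inverse flip: power_mult_distrib inverse_mult_distrib)
qed

text \<open>
  \<open>(cz + d)(m \<gamma>z + n)\<close> is again a lattice point, namely that of the row vector \<open>(m, n) \<gamma>\<close>, and
  \<open>\<gamma>\<close> maps \<open>N\<int>\<^sup>2\<close> bijectively onto itself. Absolute convergence allows the reordering.
\<close>

lemma slash_eisenstein:
  fixes \<gamma> :: "int ^ 2 ^ 2"
  assumes "N > 0" "k \<ge> 2" "Im z > 0" and \<gamma>: "\<gamma> \<in> SL2Z"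
  shows "slash (int k) \<gamma> (eisenstein k N r s) z =
    eisenstein k N (r * \<gamma>$1$1 + s * \<gamma>$2$1) (r * \<gamma>$1$2 + s * \<gamma>$2$2) z"
proof -
  let ?a = "\<gamma>$1$1" and ?b = "\<gamma>$1$2" and ?c = "\<gamma>$2$1" and ?d = "\<gamma>$2$2"
  let ?l = "lattice_point z ?c ?d powi (- int k)"
  let ?r = "r * ?a + s * ?c" and ?s = "r * ?b + s * ?d"
  have det: "?a * ?d - ?b * ?c = 1" using \<gamma> by (simp add: SL2Z_def det_2)
  have "((\<lambda>x. ?l * eisenstein_term k N r s (moebius \<gamma> z) x) has_sum
      ?l * eisenstein k N r s (moebius \<gamma> z)) UNIV"
    by (intro has_sum_cmult_right eisenstein_has_sum assms Im_moebius)
  also have "?this \<longleftrightarrow> (eisenstein_term k N ?r ?s z has_sum ?l * eisenstein k N r s (moebius \<gamma> z)) UNIV"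
  \<comment> \<open>The witnesses are right multiplication by the inverse of \<open>\<gamma>\<close> and by \<open>\<gamma>\<close>.\<close>
  proof (rule has_sum_reindex_bij_witness[of _ "\<lambda>(x, y). (x * ?d - y * ?c, y * ?a - x * ?b)"
        "\<lambda>(x, y). (x * ?a + y * ?c, x * ?b + y * ?d)"])
    fix p :: "int \<times> int"
    obtain x y where p: "p = (x, y)" by (cases p)
    have "(x * ?a + y * ?c) * ?d - (x * ?b + y * ?d) * ?c = x * (?a * ?d - ?b * ?c)"
      "(x * ?b + y * ?d) * ?a - (x * ?a + y * ?c) * ?b = y * (?a * ?d - ?b * ?c)"
      "(x * ?d - y * ?c) * ?a + (y * ?a - x * ?b) * ?c = x * (?a * ?d - ?b * ?c)"
      "(x * ?d - y * ?c) * ?b + (y * ?a - x * ?b) * ?d = y * (?a * ?d - ?b * ?c)"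
      by (simp_all add: algebra_simps)
    then show "(case case p of (x, y) \<Rightarrow> (x * ?a + y * ?c, x * ?b + y * ?d) of
          (x, y) \<Rightarrow> (x * ?d - y * ?c, y * ?a - x * ?b)) = p"
      "(case case p of (x, y) \<Rightarrow> (x * ?d - y * ?c, y * ?a - x * ?b) of
          (x, y) \<Rightarrow> (x * ?a + y * ?c, x * ?b + y * ?d)) = p"
      by (simp_all add: p det)
    have "?l * eisenstein_term k N r s (moebius \<gamma> z) (x, y) =
        ?l * lattice_recip k (moebius \<gamma> z) (int N * x + r) (int N * y + s) -
        of_bool (k = 2) * (?l * lattice_recip k (moebius \<gamma> z) (int N * x) (int N * y))"
      unfolding eisenstein_term_def by (simp add: algebra_simps)
    also have "\<dots> = eisenstein_term k N ?r ?s z (x * ?a + y * ?c, x * ?b + y * ?d)"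
      unfolding slash_lattice_recip[OF \<gamma> assms(3)] eisenstein_term_def by (simp add: algebra_simps)
    finally show "eisenstein_term k N ?r ?s z (case p of (x, y) \<Rightarrow> (x * ?a + y * ?c, x * ?b + y * ?d)) =
        ?l * eisenstein_term k N r s (moebius \<gamma> z) p"
      by (simp add: p)
  qed auto
  finally have "?l * eisenstein k N r s (moebius \<gamma> z) = eisenstein k N ?r ?s z"
    using eisenstein_has_sum[OF assms(1-3)] has_sum_unique by blast
  then show ?thesis by (simp add: slash_eq)
qed

lemma eisenstein_periodic:
  assumes "N > 0" "k \<ge> 2" "Im z > 0"
  shows "eisenstein k N r s (z + of_nat N) = eisenstein k N r s z"
proof -
  define T :: "int ^ 2 ^ 2" where "T = vector [vector [1, int N], vector [0, 1]]"
  have T: "T$1$1 = 1" "T$1$2 = int N" "T$2$1 = 0" "T$2$2 = 1" by (simp_all add: T_def)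
  have "T \<in> SL2Z" by (simp add: SL2Z_def det_2 T)
  from slash_eisenstein[OF assms this, of r s]
  have "eisenstein k N r s (z + of_nat N) = eisenstein k N r (r * int N + s) z"
    by (simp add: slash_eq moebius_def lattice_point_def T)
  also have "\<dots> = eisenstein k N r s z"
    by (rule eisenstein_cong[OF assms]) (auto simp: cong_def)
  finally show ?thesis .
qed

section \<open>Holomorphy at the cusps\<close>

lemma periodic_eq_if_nome_eq:
  fixes h :: nat
  assumes "h > 0" and per: "\<And>z. Im z > 0 \<Longrightarrow> f (z + of_nat h) = f z"
    and z: "Im z > 0" and eq: "nome (z / of_nat h) = nome (w / of_nat h)"
  shows "f z = f w"
proof -
  have shift: "f (x + of_int n * of_nat h) = f x" if x: "Im x > 0" for n x
  proof (induction n rule: int_induct[where k = 0])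
    case (step1 i)
    have "Im (x + of_int i * of_nat h) > 0" using x by simp
    from per[OF this] step1 show ?case by (simp add: algebra_simps)
  next
    case (step2 i)
    have "Im (x + of_int (i - 1) * of_nat h) > 0" using x by simp
    from per[OF this] step2 show ?case by (simp add: algebra_simps)
  qed simp
  obtain n where "2 * of_real pi * \<i> * (w / of_nat h) =
      2 * of_real pi * \<i> * (z / of_nat h) + of_real (real_of_int (2 * n) * pi) * \<i>"
    using eq[symmetric] unfolding nome_def exp_eq by auto
  then have "2 * of_real pi * \<i> * (w / of_nat h) = 2 * of_real pi * \<i> * (z / of_nat h + of_int n)"
    by (simp add: algebra_simps)
  then have "w / of_nat h = z / of_nat h + of_int n"
    by (rule mult_left_cancel[THEN iffD1, rotated]) simp
  then have "w = z + of_int n * of_nat h" using assms(1) by (simp add: field_simps)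
  with shift[OF z, of n] show ?thesis by simp
qed

text \<open>
  A periodic function on the upper half-plane is a function \<open>F\<close> of the local parameter \<open>w\<close> on the punctured
  disc. There \<open>|z|\<close> is of the order of \<open>|ln |w||\<close>, so linear growth in \<open>z\<close> implies \<open>w F(w) \<rightarrow> 0\<close>, and
  Riemann's theorem removes the singularity.
\<close>

lemma holomorphic_at_infinity_of_growth:
  fixes h :: nat
  assumes h: "h > 0" and hol: "f holomorphic_on upper_half_plane"
    and per: "\<And>z. Im z > 0 \<Longrightarrow> f (z + of_nat h) = f z"
    and growth: "\<And>z. Im z \<ge> 1 \<Longrightarrow> \<bar>Re z\<bar> \<le> h \<Longrightarrow> norm (f z) \<le> C * (1 + norm z)"
  shows "holomorphic_at_infinity f"
proof -
  define c where "c = of_nat h / (2 * of_real pi * \<i>)"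
  define F where "F = (\<lambda>w. f (c * Ln w))"
  define G where "G = (\<lambda>w. f (c * (Ln (- w) + \<i> * of_real pi)))"
  have c_ne: "c \<noteq> 0" using h by (simp add: c_def)
  have Im_c: "Im (c * l) = - real h * Re l / (2 * pi)" and Re_c: "Re (c * l) = real h * Im l / (2 * pi)" for l
    using pi_gt_zero by (simp_all add: c_def Im_divide Re_divide power2_eq_square field_simps)
  have nome_c: "nome (c * l / of_nat h) = exp l" for l
    using h by (simp add: nome_def c_def)
  have Im_pos: "Im (c * l) > 0" if "Re l < 0" for l
    unfolding Im_c using that h by (intro divide_pos_pos) (auto simp: mult_less_0_iff)
  have Re_Ln_neg: "Re (Ln w) < 0" "Re (Ln (- w) + \<i> * of_real pi) < 0" if "w \<in> ball 0 1 - {0}" for w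
    using that by auto
  have in_domain: "c * Ln w \<in> upper_half_plane" "c * (Ln (- w) + \<i> * of_real pi) \<in> upper_half_plane"
    if "w \<in> ball 0 1 - {0}" for w
    unfolding upper_half_plane_def mem_Collect_eq by (rule Im_pos, rule Re_Ln_neg[OF that])+
  \<comment> \<open>\<open>F\<close> and \<open>G\<close> use branches of the logarithm with opposite cuts; periodicity makes them agree, so \<open>F\<close> is holomorphic across its own cut.\<close>
  have FG: "F w = G w" if w: "w \<in> ball 0 1 - {0}" for w
    unfolding F_def G_def
  proof (rule periodic_eq_if_nome_eq[where f = f, OF h per])
    have "exp (Ln (- w) + \<i> * of_real pi) = w"
      using w by (simp add: exp_add)
    then show "nome (c * Ln w / of_nat h) = nome (c * (Ln (- w) + \<i> * of_real pi) / of_nat h)"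
      using w by (simp add: nome_c)
  qed (assumption, rule Im_pos, rule Re_Ln_neg(1)[OF w])
  have F_hol: "F holomorphic_on (ball 0 1 - \<real>\<^sub>\<le>\<^sub>0)"
    unfolding F_def
    by (rule holomorphic_on_compose_gen[OF _ hol, unfolded o_def])
       (auto intro!: holomorphic_intros in_domain)
  have "G holomorphic_on (ball 0 1 - \<real>\<^sub>\<ge>\<^sub>0)"
    unfolding G_def
    by (rule holomorphic_on_compose_gen[OF _ hol, unfolded o_def])
       (auto intro!: holomorphic_intros in_domain)
  then have F_hol': "F holomorphic_on (ball 0 1 - \<real>\<^sub>\<ge>\<^sub>0)"
    by (rule holomorphic_transform) (rule FG[symmetric], auto)
  have "F holomorphic_on ((ball 0 1 - \<real>\<^sub>\<le>\<^sub>0) \<union> (ball 0 1 - \<real>\<^sub>\<ge>\<^sub>0))"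
    by (intro holomorphic_on_Un F_hol F_hol' open_Diff open_ball
        closed_nonpos_Reals_complex closed_nonneg_Reals_complex)
  also have "(ball 0 1 - \<real>\<^sub>\<le>\<^sub>0) \<union> (ball 0 1 - \<real>\<^sub>\<ge>\<^sub>0) = ball 0 1 - {0::complex}"
    by (auto simp: complex_nonpos_Reals_iff complex_nonneg_Reals_iff complex_eq_iff)
  finally have F_hol'': "F holomorphic_on ball 0 1 - {0}" .
  have "((\<lambda>w. (w - 0) * F w) \<longlongrightarrow> 0) (at 0)"
  proof (rule Lim_null_comparison)
    define M where "M = (\<lambda>t::real. t * (\<bar>C\<bar> * (1 + real h * (\<bar>ln t\<bar> + pi) / (2 * pi))))"
    have "(M \<longlongrightarrow> 0) (at_right 0)"
      unfolding M_def using pi_gt_zero by real_asymp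
    moreover have "filterlim norm (at_right 0) (at (0::complex))"
      by (auto simp: filterlim_at eventually_at_filter intro!: tendsto_norm_zero tendsto_ident_at)
    ultimately show "((\<lambda>w::complex. M (norm w)) \<longlongrightarrow> 0) (at 0)"
      by (rule filterlim_compose)
    have "eventually (\<lambda>w. norm w < exp (- 2 * pi / h)) (at (0::complex))"
      by (rule order_tendstoD) (auto intro!: tendsto_norm_zero tendsto_ident_at)
    moreover have "eventually (\<lambda>w. w \<noteq> 0) (at (0::complex))"
      by (simp add: eventually_at_filter)
    ultimately show "eventually (\<lambda>w. norm ((w - 0) * F w) \<le> M (norm w)) (at 0)"
    proof eventually_elim
      case (elim w)
      let ?z = "c * Ln w"
      have "ln (norm w) < - 2 * pi / h"
        using elim by (metis exp_less_cancel_iff exp_ln zero_less_norm_iff)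
      then have "Im ?z \<ge> 1"
        using elim h unfolding Im_c by (simp add: field_simps)
      moreover have "\<bar>Im (Ln w)\<bar> \<le> pi"
        using mpi_less_Im_Ln[OF elim(2)] Im_Ln_le_pi[OF elim(2)] by simp
      then have "\<bar>Re ?z\<bar> \<le> real h * pi / (2 * pi)"
        unfolding Re_c abs_divide abs_mult by (intro divide_mono mult_mono) auto
      then have "\<bar>Re ?z\<bar> \<le> real h" by simp
      ultimately have "norm (F w) \<le> C * (1 + norm ?z)" unfolding F_def by (rule growth)
      also have "\<dots> \<le> \<bar>C\<bar> * (1 + norm ?z)" by (intro mult_right_mono) auto
      also have "norm ?z \<le> real h * (\<bar>ln (norm w)\<bar> + pi) / (2 * pi)"
      proof -
        have "norm (Ln w) \<le> \<bar>ln (norm w)\<bar> + pi"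
          using cmod_le[of "Ln w"] \<open>\<bar>Im (Ln w)\<bar> \<le> pi\<close> elim by simp
        then have "real h / (2 * pi) * norm (Ln w) \<le> real h / (2 * pi) * (\<bar>ln (norm w)\<bar> + pi)"
          by (intro mult_left_mono) auto
        then show ?thesis by (simp add: c_def norm_mult norm_divide)
      qed
      finally have "norm (F w) \<le> \<bar>C\<bar> * (1 + real h * (\<bar>ln (norm w)\<bar> + pi) / (2 * pi))"
        by (simp add: mult_left_mono)
      then show ?case unfolding M_def norm_mult by (intro mult_mono) auto
    qed
  qed
  then obtain g where g: "g holomorphic_on ball 0 1" "\<And>w. w \<in> ball 0 1 - {0} \<Longrightarrow> g w = F w"
    using holomorphic_on_extend_lim[OF F_hol''] by auto
  have "f z = g (nome (z / of_nat h))" if "z \<in> upper_half_plane" for z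
  proof -
    have z: "Im z > 0" using that by (simp add: upper_half_plane_def)
    let ?w = "nome (z / of_nat h)"
    have w: "?w \<noteq> 0" "norm ?w < 1"
      using z h by (auto simp: nome_def[of "z / _"] intro!: norm_nome_less_1)
    have "nome (c * Ln ?w / of_nat h) = ?w" using w by (simp add: nome_c)
    then have "f z = f (c * Ln ?w)"
      by (intro periodic_eq_if_nome_eq[where f = f, OF h per z]) auto
    with g(2)[of ?w] w show ?thesis by (simp add: F_def)
  qed
  with h g(1) show ?thesis unfolding holomorphic_at_infinity_def by blast
qed

text \<open>
  Functions of the parameters of periods \<open>h\<^sub>1\<close> and \<open>h\<^sub>2\<close> are functions of the parameter of period
  \<open>h\<^sub>1 h\<^sub>2\<close>, because the former parameters are powers of the latter.
\<close>

lemma holomorphic_at_infinity_common_period: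
  assumes "holomorphic_at_infinity f" "holomorphic_at_infinity g"
  obtains h F G where "(h::nat) > 0" "F holomorphic_on ball 0 1" "G holomorphic_on ball 0 1"
    "\<And>z. z \<in> upper_half_plane \<Longrightarrow> f z = F (nome (z / of_nat h))"
    "\<And>z. z \<in> upper_half_plane \<Longrightarrow> g z = G (nome (z / of_nat h))"
proof -
  obtain h1 :: nat and F where 1: "h1 > 0" "F holomorphic_on ball 0 1"
    "\<And>z. z \<in> upper_half_plane \<Longrightarrow> f z = F (nome (z / of_nat h1))"
    using assms(1) unfolding holomorphic_at_infinity_def by blast
  obtain h2 :: nat and G where 2: "h2 > 0" "G holomorphic_on ball 0 1"
    "\<And>z. z \<in> upper_half_plane \<Longrightarrow> g z = G (nome (z / of_nat h2))"
    using assms(2) unfolding holomorphic_at_infinity_def by blast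
  have pow: "(\<lambda>w. H (w ^ n)) holomorphic_on ball 0 1" if "H holomorphic_on ball 0 1" "n > 0" for H :: "complex \<Rightarrow> complex" and n :: nat
    by (rule holomorphic_on_compose_gen[OF _ that(1), unfolded o_def])
       (use that(2) in \<open>auto intro!: holomorphic_intros simp: norm_power power_less_one_iff\<close>)
  show thesis
  proof
    show "h1 * h2 > 0" using 1 2 by simp
    show "(\<lambda>w. F (w ^ h2)) holomorphic_on ball 0 1" "(\<lambda>w. G (w ^ h1)) holomorphic_on ball 0 1"
      by (intro pow 1 2)+
    fix z assume z: "z \<in> upper_half_plane"
    have "nome (z / of_nat (h1 * h2)) ^ h2 = nome (z / of_nat h1)"
      "nome (z / of_nat (h1 * h2)) ^ h1 = nome (z / of_nat h2)"
      using 1(1) 2(1) by (simp_all add: nome_def field_simps flip: exp_of_nat_mult)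
    then show "f z = F (nome (z / of_nat (h1 * h2)) ^ h2)" "g z = G (nome (z / of_nat (h1 * h2)) ^ h1)"
      using 1(3)[OF z] 2(3)[OF z] by simp_all
  qed
qed

lemma holomorphic_at_infinity_add:
  assumes "holomorphic_at_infinity f" "holomorphic_at_infinity g"
  shows "holomorphic_at_infinity (\<lambda>z. f z + g z)"
proof -
  from holomorphic_at_infinity_common_period[OF assms] obtain h F G where h: "(h::nat) > 0" and
    FG: "F holomorphic_on ball 0 1" "G holomorphic_on ball 0 1" and
    eq: "\<And>z. z \<in> upper_half_plane \<Longrightarrow> f z = F (nome (z / of_nat h))"
    "\<And>z. z \<in> upper_half_plane \<Longrightarrow> g z = G (nome (z / of_nat h))" by blast
  have "(\<lambda>w. F w + G w) holomorphic_on ball 0 1" by (intro holomorphic_intros FG)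
  then show ?thesis
    unfolding holomorphic_at_infinity_def using h eq
    by (intro exI[of _ h] conjI exI[of _ "\<lambda>w. F w + G w"]) auto
qed

lemma holomorphic_at_infinity_mult:
  assumes "holomorphic_at_infinity f" "holomorphic_at_infinity g"
  shows "holomorphic_at_infinity (\<lambda>z. f z * g z)"
proof -
  from holomorphic_at_infinity_common_period[OF assms] obtain h F G where h: "(h::nat) > 0" and
    FG: "F holomorphic_on ball 0 1" "G holomorphic_on ball 0 1" and
    eq: "\<And>z. z \<in> upper_half_plane \<Longrightarrow> f z = F (nome (z / of_nat h))"
    "\<And>z. z \<in> upper_half_plane \<Longrightarrow> g z = G (nome (z / of_nat h))" by blast
  have "(\<lambda>w. F w * G w) holomorphic_on ball 0 1" by (intro holomorphic_intros FG)
  then show ?thesis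
    unfolding holomorphic_at_infinity_def using h eq
    by (intro exI[of _ h] conjI exI[of _ "\<lambda>w. F w * G w"]) auto
qed

lemma holomorphic_at_infinity_const: "holomorphic_at_infinity (\<lambda>_. c)"
  unfolding holomorphic_at_infinity_def
  by (intro exI[of _ 1] conjI exI[of _ "\<lambda>_. c"]) auto

lemma holomorphic_at_infinity_cong:
  assumes "\<And>z. z \<in> upper_half_plane \<Longrightarrow> f z = g z"
  shows "holomorphic_at_infinity f \<longleftrightarrow> holomorphic_at_infinity g"
  unfolding holomorphic_at_infinity_def using assms by (metis (no_types, lifting))

lemma eisenstein_holomorphic_at_infinity:
  assumes "N > 0" "k \<ge> 2"
  shows "holomorphic_at_infinity (eisenstein k N r s)"
proof -
  obtain C where C: "\<And>z. Im z \<ge> 1 \<Longrightarrow> \<bar>Re z\<bar> \<le> real N \<Longrightarrow> norm (eisenstein k N r s z) \<le> C * (1 + norm z)"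
    using eisenstein_linear_growth[OF assms, of "real N" r s] by auto
  show ?thesis
    by (rule holomorphic_at_infinity_of_growth[OF assms(1) eisenstein_holomorphic[OF assms] _ C])
       (auto intro: eisenstein_periodic assms)
qed

lemma holomorphic_at_infinity_sum:
  assumes "\<And>i. i \<in> I \<Longrightarrow> holomorphic_at_infinity (f i)"
  shows "holomorphic_at_infinity (\<lambda>z. \<Sum>i\<in>I. f i z)"
  using assms
  by (induction I rule: infinite_finite_induct)
     (auto intro: holomorphic_at_infinity_const holomorphic_at_infinity_add)

section \<open>Eisenstein series of a set of residues\<close>

definition residue_eisenstein :: "nat \<Rightarrow> nat \<Rightarrow> int set \<Rightarrow> complex \<Rightarrow> complex" where
  "residue_eisenstein k N S z = (\<Sum>a\<in>S. \<Sum>s\<in>{0..<int N}. eisenstein k N a s z)"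

lemma slash_residue_eisenstein:
  fixes \<gamma> :: "int ^ 2 ^ 2"
  assumes "N > 0" "k \<ge> 2" "Im z > 0" "\<gamma> \<in> SL2Z"
  shows "slash (int k) \<gamma> (residue_eisenstein k N S) z =
    (\<Sum>a\<in>S. \<Sum>s\<in>{0..<int N}. eisenstein k N (a * \<gamma>$1$1 + s * \<gamma>$2$1) (a * \<gamma>$1$2 + s * \<gamma>$2$2) z)"
proof -
  have "slash (int k) \<gamma> (residue_eisenstein k N S) z =
      (\<Sum>a\<in>S. \<Sum>s\<in>{0..<int N}. slash (int k) \<gamma> (eisenstein k N a s) z)"
    unfolding slash_def residue_eisenstein_def by (simp only: sum_distrib_left)
  then show ?thesis by (simp only: slash_eisenstein[OF assms])
qed

text \<open>
  For \<open>\<gamma> \<in> \<Gamma>\<^sub>1(N)\<close> the class \<open>(a, s) \<gamma>\<close> is \<open>(a, ab + s)\<close> modulo \<open>N\<close>, where \<open>b\<close> is the upper right entry of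
  \<open>\<gamma>\<close>; so \<open>\<gamma>\<close> permutes the summands with given \<open>a\<close>. At a cusp a general \<open>\<gamma>\<close> replaces the summands by other
  regularised Eisenstein series of level \<open>N\<close>, which are all holomorphic at infinity.
\<close>

lemma residue_eisenstein_modular:
  assumes "N > 0" "k \<ge> 2"
  shows "residue_eisenstein k N S \<in> modular_forms (int k) (Gamma1 N)"
  unfolding modular_forms_def
proof (intro CollectI conjI ballI)
  show "residue_eisenstein k N S holomorphic_on upper_half_plane"
    unfolding residue_eisenstein_def[abs_def] by (intro holomorphic_on_sum eisenstein_holomorphic assms)
next
  fix \<gamma> z assume \<gamma>: "\<gamma> \<in> Gamma1 N" and "z \<in> upper_half_plane"
  then have z: "Im z > 0" by (simp add: upper_half_plane_def)
  have SL: "\<gamma> \<in> SL2Z" and c: "[\<gamma>$2$1 = 0] (mod int N)" and a: "[\<gamma>$1$1 = 1] (mod int N)"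
    and d: "[\<gamma>$2$2 = 1] (mod int N)"
    using \<gamma> by (auto simp: Gamma1_def)
  have "(\<Sum>s\<in>{0..<int N}. eisenstein k N (t * \<gamma>$1$1 + s * \<gamma>$2$1) (t * \<gamma>$1$2 + s * \<gamma>$2$2) z) =
      (\<Sum>s\<in>{0..<int N}. eisenstein k N t s z)" (is "?lhs = _") for t
  proof -
    have "?lhs = (\<Sum>s\<in>{0..<int N}. eisenstein k N t ((t * \<gamma>$1$2 + s) mod int N) z)"
    proof (intro sum.cong refl eisenstein_cong assms z)
      fix s
      have "[t * \<gamma>$1$1 + s * \<gamma>$2$1 = t * 1 + s * 0] (mod int N)"
        by (intro cong_add cong_mult cong_refl a c)
      then show "[t * \<gamma>$1$1 + s * \<gamma>$2$1 = t] (mod int N)" by simp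
      have "[t * \<gamma>$1$2 + s * \<gamma>$2$2 = t * \<gamma>$1$2 + s * 1] (mod int N)"
        by (intro cong_add cong_mult cong_refl d)
      then show "[t * \<gamma>$1$2 + s * \<gamma>$2$2 = (t * \<gamma>$1$2 + s) mod int N] (mod int N)"
        by (simp add: cong_def)
    qed
    also have "\<dots> = (\<Sum>s\<in>{0..<int N}. eisenstein k N t s z)"
      by (rule sum.reindex_bij_witness[of _ "\<lambda>s. (s - t * \<gamma>$1$2) mod int N" "\<lambda>s. (t * \<gamma>$1$2 + s) mod int N"])
         (use assms in \<open>auto simp: mod_simps algebra_simps\<close>)
    finally show ?thesis .
  qed
  then show "slash (int k) \<gamma> (residue_eisenstein k N S) z = residue_eisenstein k N S z"
    by (simp add: slash_residue_eisenstein[OF assms z SL] residue_eisenstein_def)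
next
  fix \<gamma> :: "int ^ 2 ^ 2" assume \<gamma>: "\<gamma> \<in> SL2Z"
  have "holomorphic_at_infinity (\<lambda>z. \<Sum>a\<in>S. \<Sum>s\<in>{0..<int N}.
      eisenstein k N (a * \<gamma>$1$1 + s * \<gamma>$2$1) (a * \<gamma>$1$2 + s * \<gamma>$2$2) z)"
    by (intro holomorphic_at_infinity_sum eisenstein_holomorphic_at_infinity assms)
  also have "?this \<longleftrightarrow> holomorphic_at_infinity (slash (int k) \<gamma> (residue_eisenstein k N S))"
    by (rule holomorphic_at_infinity_cong)
       (simp add: slash_residue_eisenstein[OF assms _ \<gamma>] upper_half_plane_def)
  finally show "holomorphic_at_infinity (slash (int k) \<gamma> (residue_eisenstein k N S))" .
qed

section \<open>Fourier expansion\<close>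

lemma has_sum_finite_sum:
  fixes f :: "'a \<Rightarrow> 'b \<Rightarrow> complex"
  assumes "\<And>i. i \<in> I \<Longrightarrow> (f i has_sum x i) A"
  shows "((\<lambda>y. \<Sum>i\<in>I. f i y) has_sum (\<Sum>i\<in>I. x i)) A"
  using assms by (induction I rule: infinite_finite_induct) (auto intro: has_sum_add)

lemma has_sum_residues:
  fixes f :: "int \<Rightarrow> complex"
  assumes "N > 0" "S \<subseteq> {0..<int N}" "(f has_sum x) {m. m mod int N \<in> S}"
  shows "((\<lambda>(a, t). f (int N * t + a)) has_sum x) (S \<times> UNIV)"
proof -
  have "(int N * t + a) mod int N = a \<and> (int N * t + a) div int N = t" if "a \<in> S" for a t
    using that assms(1,2) by auto
  then show ?thesis
    using assms(3)
    by (subst has_sum_reindex_bij_witness[of _ "\<lambda>m. (m mod int N, m div int N)" "\<lambda>(a, t). int N * t + a"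
        "{m. m mod int N \<in> S}" f _ x]) auto
qed

lemma row_sum_residues:
  assumes "N > 0" "k \<ge> 2"
  shows "(\<Sum>s\<in>{0..<int N}. \<Sum>\<^sub>\<infinity>b. 1 / (\<tau> + of_int (int N * b + s)) ^ k) = row_sum k \<tau>"
proof -
  let ?f = "\<lambda>n. 1 / (\<tau> + of_int n) ^ k"
  have mods: "{m. m mod int N \<in> {0..<int N}} = UNIV" using assms(1) by auto
  have sum: "((\<lambda>(s, b). ?f (int N * b + s)) has_sum row_sum k \<tau>) ({0..<int N} \<times> UNIV)"
    by (rule has_sum_residues[OF assms(1) order_refl]) (use row_sum_has_sum[OF assms(2)] mods in simp)
  then have "((\<lambda>s. \<Sum>\<^sub>\<infinity>b. ?f (int N * b + s)) has_sum row_sum k \<tau>) {0..<int N}"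
  proof (rule has_sum_SigmaD)
    fix s assume s: "s \<in> {0..<int N}"
    from sum have "(\<lambda>(s, b). ?f (int N * b + s)) summable_on ({0..<int N} \<times> UNIV)"
      by (rule has_sum_imp_summable)
    from summable_on_SigmaD1[OF this s]
    show "((\<lambda>b. case (s, b) of (s, b) \<Rightarrow> ?f (int N * b + s)) has_sum (\<Sum>\<^sub>\<infinity>b. ?f (int N * b + s))) UNIV"
      by simp
  qed
  then show ?thesis using has_sum_finite[of "{0..<int N}"] has_sum_unique by blast
qed

lemma nome_mult_of_nat: "nome (of_nat m * z) = nome z ^ m"
  by (simp add: nome_def mult_ac flip: exp_of_nat_mult)

text \<open>
  The rows \<open>m\<close> and \<open>-m\<close> have the same sum since \<open>k\<close> is even, and both occur since \<open>S\<close> is symmetric. The row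
  \<open>m = 0\<close>, present if \<open>0 \<in> S\<close>, contributes a constant.
\<close>

lemma row_sum_has_sum_residues:
  assumes "N > 0" and sym: "symmetric_residues S N" and k: "k \<ge> 2" "even k" and z: "Im z > 0"
  shows "((\<lambda>m. row_sum k (of_int m * z)) has_sum
     of_bool (0 \<in> S) * row_sum k 0 + 2 * lipschitz_const k * macmahon_G S N k (nome z)) {m. m mod int N \<in> S}"
proof -
  let ?f = "\<lambda>m. row_sum k (of_int m * z)" and ?x = "lipschitz_const k * macmahon_G S N k (nome z)"
  let ?P = "{m. m > 0 \<and> m mod int N \<in> S}" and ?M = "{m. m < 0 \<and> m mod int N \<in> S}"
    and ?O = "{m::int. m = 0 \<and> 0 \<in> S}"
  have "((\<lambda>m. lipschitz_const k * polylog_neg (k - 1) (nome z ^ m)) has_sum ?x) (residue_class_union S N)"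
    by (intro has_sum_cmult_right macmahon_G_Lambert norm_nome_less_1 z k)
  also have "?this \<longleftrightarrow> (?f has_sum ?x) ?P"
  proof (rule has_sum_reindex_bij_witness[of _ nat int])
    fix m assume "m \<in> residue_class_union S N"
    then have "Im (of_nat m * z) > 0" using z by (simp add: residue_class_union_def)
    from Lipschitz_formula[OF this k(1)]
    show "?f (int m) = lipschitz_const k * polylog_neg (k - 1) (nome z ^ m)"
      by (simp add: nome_mult_of_nat)
  qed (auto simp: residue_class_union_def residue_in_def)
  finally have P: "(?f has_sum ?x) ?P" .
  have neg: "(- m) mod int N \<in> S" if "m mod int N \<in> S" for m
    using sym that unfolding symmetric_residues_def by (metis mod_minus_eq)
  have M: "(?f has_sum ?x) ?M"
    by (rule has_sum_reindex_bij_witness[of ?M uminus uminus ?P, THEN iffD2, OF _ _ _ _ _ _ P])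
       (auto simp: neg row_sum_uminus[OF k(2)])
  have O: "(?f has_sum of_bool (0 \<in> S) * row_sum k 0) ?O"
    by (rule has_sum_finiteI) auto
  have "(?f has_sum (?x + ?x) + of_bool (0 \<in> S) * row_sum k 0) ((?P \<union> ?M) \<union> ?O)"
    by (intro has_sum_Un_disjoint P M O) auto
  moreover have "(?P \<union> ?M) \<union> ?O = {m. m mod int N \<in> S}" by (auto simp: not_less_iff_gr_or_eq)
  ultimately show ?thesis by (simp add: algebra_simps)
qed

text \<open>
  Sum over \<open>B\<close> and \<open>s\<close> first. For each \<open>A\<close> and \<open>a\<close> this yields the full row of \<open>NA + a\<close> minus, for \<open>k = 2\<close>,
  \<open>N\<close> copies of the sum over \<open>N\<int>\<close>, which is the row of \<open>A\<close> scaled by \<open>N\<^bsup>-k\<^esup>\<close>. After these inner summations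
  the two parts converge separately over \<open>A\<close>, and Lipschitz' formula evaluates both. The second is the case
  of level \<open>1\<close>, where \<open>{0}\<close> is the set of all residues.
\<close>

lemma residue_eisenstein_eq:
  assumes N: "N > 0" and S: "S \<subseteq> {0..<int N}" and sym: "symmetric_residues S N"
    and k: "k \<ge> 2" "even k" and z: "Im z > 0"
  shows "residue_eisenstein k N S z =
     (of_bool (0 \<in> S) * row_sum k 0 + 2 * lipschitz_const k * macmahon_G S N k (nome z)) -
     of_bool (k = 2) * (of_nat (card S * N) / of_nat N ^ k) *
       (row_sum k 0 + 2 * lipschitz_const k * macmahon_G {0} 1 k (nome z))"
proof -
  let ?h = "\<lambda>a s A B. lattice_recip k z (int N * A + a) (int N * B + s)"
  let ?U = "\<lambda>a s A. \<Sum>\<^sub>\<infinity>B. ?h a s A B"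
  let ?\<epsilon> = "of_bool (k = 2) :: complex" and ?c = "of_nat (card S * N) / of_nat N ^ k :: complex"
  let ?W = "of_bool (0 \<in> S) * row_sum k 0 + 2 * lipschitz_const k * macmahon_G S N k (nome z)"
  let ?W1 = "row_sum k 0 + 2 * lipschitz_const k * macmahon_G {0} 1 k (nome z)"
  have fin: "finite S" using S finite_subset by blast
  have "((\<lambda>A. ?U a s A - ?\<epsilon> * ?U 0 0 A) has_sum eisenstein k N a s z) UNIV" for a s
  proof (rule has_sum_SigmaD)
    show "(eisenstein_term k N a s z has_sum eisenstein k N a s z) (UNIV \<times> UNIV)"
      using eisenstein_has_sum[OF N k(1) z] by simp
    fix A
    have "((\<lambda>B. ?h a s A B + - (?\<epsilon> * ?h 0 0 A B)) has_sum ?U a s A + - (?\<epsilon> * ?U 0 0 A)) UNIV"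
      by (intro has_sum_add has_sum_uminusI has_sum_cmult_right has_sum_infsum
          lattice_recip_coset_summable(2)[OF N k(1) z])
    then show "((\<lambda>B. eisenstein_term k N a s z (A, B)) has_sum ?U a s A - ?\<epsilon> * ?U 0 0 A) UNIV"
      by (simp add: eisenstein_term_def)
  qed
  then have "((\<lambda>A. \<Sum>a\<in>S. \<Sum>s\<in>{0..<int N}. ?U a s A - ?\<epsilon> * ?U 0 0 A) has_sum residue_eisenstein k N S z) UNIV"
    unfolding residue_eisenstein_def by (intro has_sum_finite_sum)
  moreover have "(\<Sum>a\<in>S. \<Sum>s\<in>{0..<int N}. ?U a s A - ?\<epsilon> * ?U 0 0 A) =
      (\<Sum>a\<in>S. row_sum k (of_int (int N * A + a) * z)) + - (?\<epsilon> * ?c * row_sum k (of_int A * z))" for A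
  proof -
    have "(\<Sum>s\<in>{0..<int N}. ?U a s A) = row_sum k (of_int (int N * A + a) * z)" for a
      using row_sum_residues[OF N k(1)] unfolding lattice_recip_def lattice_point_def .
    moreover have "?U 0 0 A = row_sum k (of_int A * z) / of_nat N ^ k"
    proof -
      have "?h 0 0 A B = 1 / (of_int A * z + of_int B) ^ k * (1 / of_nat N ^ k)" for B
      proof -
        have "lattice_point z (int N * A) (int N * B) = of_nat N * (of_int A * z + of_int B)"
          by (simp add: lattice_point_def algebra_simps)
        then show ?thesis by (simp add: lattice_recip_def power_mult_distrib mult.commute)
      qed
      then have "?U 0 0 A = (\<Sum>\<^sub>\<infinity>B. 1 / (of_int A * z + of_int B) ^ k * (1 / of_nat N ^ k))" by simp
      also have "\<dots> = row_sum k (of_int A * z) * (1 / of_nat N ^ k)"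
        unfolding row_sum_def by (rule infsum_cmult_left')
      finally show ?thesis by simp
    qed
    ultimately show ?thesis by (simp add: sum_subtractf)
  qed
  ultimately have "((\<lambda>A. (\<Sum>a\<in>S. row_sum k (of_int (int N * A + a) * z)) + - (?\<epsilon> * ?c * row_sum k (of_int A * z)))
      has_sum residue_eisenstein k N S z) UNIV"
    by (simp only:)
  moreover have "((\<lambda>A. (\<Sum>a\<in>S. row_sum k (of_int (int N * A + a) * z)) + - (?\<epsilon> * ?c * row_sum k (of_int A * z)))
      has_sum ?W + - (?\<epsilon> * ?c * ?W1)) UNIV"
  proof (intro has_sum_add has_sum_uminusI has_sum_cmult_right)
    have "((\<lambda>(a, A). row_sum k (of_int (int N * A + a) * z)) has_sum ?W) (S \<times> UNIV)"
      by (rule has_sum_residues[OF N S row_sum_has_sum_residues[OF N sym k z]])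
    then have "((\<lambda>(A, a). row_sum k (of_int (int N * A + a) * z)) has_sum ?W) (UNIV \<times> S)"
      by (subst has_sum_swap) simp
    then show "((\<lambda>A. \<Sum>a\<in>S. row_sum k (of_int (int N * A + a) * z)) has_sum ?W) UNIV"
      by (rule has_sum_SigmaD) (auto intro: has_sum_finiteI fin)
    have "symmetric_residues {0} 1" by (simp add: symmetric_residues_def)
    from row_sum_has_sum_residues[OF zero_less_one this k z]
    show "((\<lambda>A. row_sum k (of_int A * z)) has_sum ?W1) UNIV" by simp
  qed
  ultimately show ?thesis using has_sum_unique by fastforce
qed

section \<open>The ring of quasi-modular forms\<close>

lemma slash_mult:
  fixes \<gamma> :: "int ^ 2 ^ 2"
  assumes "\<gamma> \<in> SL2Z" "z \<in> upper_half_plane"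
  shows "slash (k + l) \<gamma> (\<lambda>z. f z * g z) z = slash k \<gamma> f z * slash l \<gamma> g z"
proof -
  have "lattice_point z (\<gamma>$2$1) (\<gamma>$2$2) \<noteq> 0"
    using assms by (simp add: SL2Z_denominator_nonzero upper_half_plane_def)
  then have "lattice_point z (\<gamma>$2$1) (\<gamma>$2$2) powi (- k + - l) =
      lattice_point z (\<gamma>$2$1) (\<gamma>$2$2) powi (- k) * lattice_point z (\<gamma>$2$1) (\<gamma>$2$2) powi (- l)"
    by (intro power_int_add) auto
  then show ?thesis by (simp add: slash_eq mult_ac)
qed

lemma slash_add: "slash k \<gamma> (\<lambda>z. f z + g z) z = slash k \<gamma> f z + slash k \<gamma> g z"
  by (simp add: slash_def distrib_left)

lemma modular_forms_add:
  assumes "f \<in> modular_forms k \<Gamma>" "g \<in> modular_forms k \<Gamma>"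
  shows "(\<lambda>z. f z + g z) \<in> modular_forms k \<Gamma>"
  using assms unfolding modular_forms_def mem_Collect_eq slash_add[abs_def]
  by (auto intro: holomorphic_on_add holomorphic_at_infinity_add)

lemma modular_forms_mult:
  assumes \<Gamma>: "\<Gamma> \<subseteq> SL2Z" and f: "f \<in> modular_forms k \<Gamma>" and g: "g \<in> modular_forms l \<Gamma>"
  shows "(\<lambda>z. f z * g z) \<in> modular_forms (k + l) \<Gamma>"
  unfolding modular_forms_def
proof (intro CollectI conjI ballI)
  show "(\<lambda>z. f z * g z) holomorphic_on upper_half_plane"
    using f g by (intro holomorphic_on_mult) (auto simp: modular_forms_def)
  show "slash (k + l) \<gamma> (\<lambda>z. f z * g z) z = f z * g z" if "\<gamma> \<in> \<Gamma>" "z \<in> upper_half_plane" for \<gamma> z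
    using that \<Gamma> f g by (subst slash_mult) (auto simp: modular_forms_def)
  fix \<gamma> :: "int ^ 2 ^ 2" assume \<gamma>: "\<gamma> \<in> SL2Z"
  have "holomorphic_at_infinity (\<lambda>z. slash k \<gamma> f z * slash l \<gamma> g z)"
    using f g \<gamma> by (intro holomorphic_at_infinity_mult) (auto simp: modular_forms_def)
  also have "?this \<longleftrightarrow> holomorphic_at_infinity (slash (k + l) \<gamma> (\<lambda>z. f z * g z))"
    by (rule holomorphic_at_infinity_cong) (simp add: slash_mult[OF \<gamma>])
  finally show "holomorphic_at_infinity (slash (k + l) \<gamma> (\<lambda>z. f z * g z))" .
qed

lemma const_modular_form: "(\<lambda>_. c) \<in> modular_forms 0 \<Gamma>"
  unfolding modular_forms_def slash_def[abs_def]
  by (auto intro: holomorphic_at_infinity_const)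

lemma zero_modular_form: "(\<lambda>_. 0) \<in> modular_forms k \<Gamma>"
  unfolding modular_forms_def slash_def[abs_def]
  by (auto intro: holomorphic_at_infinity_const)

lemma mixed_modular_forms_cong:
  assumes "f \<in> mixed_modular_forms \<Gamma>" "\<And>z. z \<in> upper_half_plane \<Longrightarrow> g z = f z"
  shows "g \<in> mixed_modular_forms \<Gamma>"
  using assms unfolding mixed_modular_forms_def by auto

lemma modular_form_imp_mixed: "f \<in> modular_forms k \<Gamma> \<Longrightarrow> f \<in> mixed_modular_forms \<Gamma>"
  unfolding mixed_modular_forms_def by (intro CollectI exI[of _ "{k}"] exI[of _ "\<lambda>_. f"]) auto

lemma const_mixed: "(\<lambda>_. c) \<in> mixed_modular_forms \<Gamma>"
  by (rule modular_form_imp_mixed[OF const_modular_form])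

lemma mixed_modular_forms_add:
  assumes "f \<in> mixed_modular_forms \<Gamma>" "g \<in> mixed_modular_forms \<Gamma>"
  shows "(\<lambda>z. f z + g z) \<in> mixed_modular_forms \<Gamma>"
proof -
  obtain K F where F: "finite K" "\<And>k. k \<in> K \<Longrightarrow> F k \<in> modular_forms k \<Gamma>"
    "\<And>z. z \<in> upper_half_plane \<Longrightarrow> f z = (\<Sum>k\<in>K. F k z)"
    using assms(1) unfolding mixed_modular_forms_def by blast
  obtain L G where G: "finite L" "\<And>k. k \<in> L \<Longrightarrow> G k \<in> modular_forms k \<Gamma>"
    "\<And>z. z \<in> upper_half_plane \<Longrightarrow> g z = (\<Sum>k\<in>L. G k z)"
    using assms(2) unfolding mixed_modular_forms_def by blast
  define F' where "F' = (\<lambda>k. if k \<in> K then F k else (\<lambda>_. 0))"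
  define G' where "G' = (\<lambda>k. if k \<in> L then G k else (\<lambda>_. 0))"
  have "f z + g z = (\<Sum>k\<in>K \<union> L. F' k z + G' k z)" if "z \<in> upper_half_plane" for z
  proof -
    have "f z = (\<Sum>k\<in>K \<union> L. F' k z)"
      unfolding F(3)[OF that] using F(1) G(1) by (intro sum.mono_neutral_cong_left) (auto simp: F'_def)
    moreover have "g z = (\<Sum>k\<in>K \<union> L. G' k z)"
      unfolding G(3)[OF that] using F(1) G(1) by (intro sum.mono_neutral_cong_left) (auto simp: G'_def)
    ultimately show ?thesis by (simp add: sum.distrib)
  qed
  moreover have "(\<lambda>z. F' k z + G' k z) \<in> modular_forms k \<Gamma>" for k
    by (rule modular_forms_add) (auto simp: F'_def G'_def F G zero_modular_form)
  ultimately show ?thesis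
    unfolding mixed_modular_forms_def using F(1) G(1)
    by (intro CollectI exI[of _ "K \<union> L"] exI[of _ "\<lambda>k z. F' k z + G' k z"]) auto
qed

lemma mixed_modular_forms_sum:
  assumes "\<And>i. i \<in> I \<Longrightarrow> f i \<in> mixed_modular_forms \<Gamma>"
  shows "(\<lambda>z. \<Sum>i\<in>I. f i z) \<in> mixed_modular_forms \<Gamma>"
  using assms
  by (induction I rule: infinite_finite_induct) (auto intro: const_mixed mixed_modular_forms_add)

lemma mixed_modular_forms_mult:
  assumes \<Gamma>: "\<Gamma> \<subseteq> SL2Z" and "f \<in> mixed_modular_forms \<Gamma>" "g \<in> mixed_modular_forms \<Gamma>"
  shows "(\<lambda>z. f z * g z) \<in> mixed_modular_forms \<Gamma>"
proof -
  obtain K F where F: "\<And>k. k \<in> K \<Longrightarrow> F k \<in> modular_forms k \<Gamma>"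
    "\<And>z. z \<in> upper_half_plane \<Longrightarrow> f z = (\<Sum>k\<in>K. F k z)"
    using assms(2) unfolding mixed_modular_forms_def by blast
  obtain L G where G: "\<And>k. k \<in> L \<Longrightarrow> G k \<in> modular_forms k \<Gamma>"
    "\<And>z. z \<in> upper_half_plane \<Longrightarrow> g z = (\<Sum>k\<in>L. G k z)"
    using assms(3) unfolding mixed_modular_forms_def by blast
  have "(\<lambda>z. \<Sum>k\<in>K. \<Sum>l\<in>L. F k z * G l z) \<in> mixed_modular_forms \<Gamma>"
    by (intro mixed_modular_forms_sum modular_form_imp_mixed[OF modular_forms_mult[OF \<Gamma> F(1) G(1)]])
  then show ?thesis
    by (rule mixed_modular_forms_cong) (simp add: F(2) G(2) sum_product)
qed

lemma quasimodular_forms_cong: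
  assumes "f \<in> quasimodular_forms \<Gamma>" "\<And>z. z \<in> upper_half_plane \<Longrightarrow> g z = f z"
  shows "g \<in> quasimodular_forms \<Gamma>"
  using assms unfolding quasimodular_forms_def by auto

lemma quasimodular_monomial:
  assumes "c \<in> mixed_modular_forms \<Gamma>"
  shows "(\<lambda>z. c z * Eisenstein_E2 z ^ i) \<in> quasimodular_forms \<Gamma>"
  unfolding quasimodular_forms_def
proof (intro CollectI exI conjI allI impI ballI)
  let ?c = "\<lambda>j. if j = i then c else (\<lambda>_. 0)"
  show "?c j \<in> mixed_modular_forms \<Gamma>" for j
    using assms const_mixed by simp
  fix z
  have "(\<Sum>j\<le>i. ?c j z * Eisenstein_E2 z ^ j) = (\<Sum>j\<le>i. if j = i then c z * Eisenstein_E2 z ^ i else 0)"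
    by (intro sum.cong) auto
  then show "c z * Eisenstein_E2 z ^ i = (\<Sum>j\<le>i. ?c j z * Eisenstein_E2 z ^ j)" by simp
qed

lemma mixed_imp_quasimodular: "c \<in> mixed_modular_forms \<Gamma> \<Longrightarrow> c \<in> quasimodular_forms \<Gamma>"
  using quasimodular_monomial[of c \<Gamma> 0] by simp

lemma quasimodular_forms_add:
  assumes "f \<in> quasimodular_forms \<Gamma>" "g \<in> quasimodular_forms \<Gamma>"
  shows "(\<lambda>z. f z + g z) \<in> quasimodular_forms \<Gamma>"
proof -
  obtain m c where c: "\<And>i. i \<le> m \<Longrightarrow> c i \<in> mixed_modular_forms \<Gamma>"
    "\<And>z. z \<in> upper_half_plane \<Longrightarrow> f z = (\<Sum>i\<le>(m::nat). c i z * Eisenstein_E2 z ^ i)"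
    using assms(1) unfolding quasimodular_forms_def by blast
  obtain n d where d: "\<And>i. i \<le> n \<Longrightarrow> d i \<in> mixed_modular_forms \<Gamma>"
    "\<And>z. z \<in> upper_half_plane \<Longrightarrow> g z = (\<Sum>i\<le>(n::nat). d i z * Eisenstein_E2 z ^ i)"
    using assms(2) unfolding quasimodular_forms_def by blast
  define c' where "c' = (\<lambda>i. if i \<le> m then c i else (\<lambda>_. 0))"
  define d' where "d' = (\<lambda>i. if i \<le> n then d i else (\<lambda>_. 0))"
  have "f z + g z = (\<Sum>i\<le>max m n. (c' i z + d' i z) * Eisenstein_E2 z ^ i)" if "z \<in> upper_half_plane" for z
  proof -
    have "f z = (\<Sum>i\<le>max m n. c' i z * Eisenstein_E2 z ^ i)"
      unfolding c(2)[OF that] by (intro sum.mono_neutral_cong_left) (auto simp: c'_def)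
    moreover have "g z = (\<Sum>i\<le>max m n. d' i z * Eisenstein_E2 z ^ i)"
      unfolding d(2)[OF that] by (intro sum.mono_neutral_cong_left) (auto simp: d'_def)
    ultimately show ?thesis by (simp add: sum.distrib distrib_right)
  qed
  moreover have "(\<lambda>z. c' i z + d' i z) \<in> mixed_modular_forms \<Gamma>" for i
    by (rule mixed_modular_forms_add) (auto simp: c'_def d'_def c d const_mixed)
  ultimately show ?thesis
    unfolding quasimodular_forms_def
    by (intro CollectI exI[of _ "max m n"] exI[of _ "\<lambda>i z. c' i z + d' i z"]) auto
qed

lemma quasimodular_forms_sum:
  assumes "\<And>i. i \<in> I \<Longrightarrow> f i \<in> quasimodular_forms \<Gamma>"
  shows "(\<lambda>z. \<Sum>i\<in>I. f i z) \<in> quasimodular_forms \<Gamma>"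
  using assms
  by (induction I rule: infinite_finite_induct)
     (auto intro: mixed_imp_quasimodular const_mixed quasimodular_forms_add)

lemma quasimodular_forms_mult:
  assumes \<Gamma>: "\<Gamma> \<subseteq> SL2Z" and "f \<in> quasimodular_forms \<Gamma>" "g \<in> quasimodular_forms \<Gamma>"
  shows "(\<lambda>z. f z * g z) \<in> quasimodular_forms \<Gamma>"
proof -
  obtain m c where c: "\<And>i. i \<le> m \<Longrightarrow> c i \<in> mixed_modular_forms \<Gamma>"
    "\<And>z. z \<in> upper_half_plane \<Longrightarrow> f z = (\<Sum>i\<le>(m::nat). c i z * Eisenstein_E2 z ^ i)"
    using assms(2) unfolding quasimodular_forms_def by blast
  obtain n d where d: "\<And>i. i \<le> n \<Longrightarrow> d i \<in> mixed_modular_forms \<Gamma>"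
    "\<And>z. z \<in> upper_half_plane \<Longrightarrow> g z = (\<Sum>i\<le>(n::nat). d i z * Eisenstein_E2 z ^ i)"
    using assms(3) unfolding quasimodular_forms_def by blast
  have "(\<lambda>z. \<Sum>i\<le>m. \<Sum>j\<le>n. (c i z * d j z) * Eisenstein_E2 z ^ (i + j)) \<in> quasimodular_forms \<Gamma>"
    by (intro quasimodular_forms_sum quasimodular_monomial mixed_modular_forms_mult[OF \<Gamma>] c(1) d(1)) auto
  then show ?thesis
    by (rule quasimodular_forms_cong) (simp add: c(2) d(2) sum_product power_add mult_ac)
qed

lemma function_algebra_quasimodular_forms:
  assumes "\<Gamma> \<subseteq> SL2Z"
  shows "function_algebra (quasimodular_forms \<Gamma>)"
  by unfold_locales
     (auto intro: mixed_imp_quasimodular const_mixed quasimodular_forms_add quasimodular_forms_mult[OF assms])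

lemma Eisenstein_E2_quasimodular: "Eisenstein_E2 \<in> quasimodular_forms \<Gamma>"
  using quasimodular_monomial[OF const_mixed[of 1], of 1] by simp

lemma macmahon_G_all_eq: "macmahon_G {0} 1 2 (nome z) = (1 - Eisenstein_E2 z) / 24"
  by (simp add: macmahon_G_def Eisenstein_E2_def residue_in_def)

text \<open>
  Solve the Fourier expansion of the Eisenstein series for \<open>G\<^bsub>S,N,k\<^esub>\<close>. For \<open>k = 2\<close> the level \<open>1\<close> divisor sum
  that appears is \<open>(1 - E\<^sub>2) / 24\<close>; for larger \<open>k\<close> only modular forms of weights \<open>k\<close> and \<open>0\<close> remain.
\<close>

lemma macmahon_G_quasimodular:
  assumes N: "N > 0" and S: "S \<subseteq> {0..<int N}" and sym: "symmetric_residues S N"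
    and k: "k \<ge> 2" "even k"
  shows "(\<lambda>z. macmahon_G S N k (nome z)) \<in> quasimodular_forms (Gamma1 N)"
proof -
  interpret function_algebra "quasimodular_forms (Gamma1 N)"
    by (rule function_algebra_quasimodular_forms) (auto simp: Gamma1_def)
  let ?c = "of_nat (card S * N) / of_nat N ^ k :: complex"
  let ?\<kappa> = "lipschitz_const k"
  let ?rhs = "\<lambda>z. 1 / (2 * ?\<kappa>) * (residue_eisenstein k N S z + - of_bool (0 \<in> S) * row_sum k 0) +
      of_bool (k = 2) * ?c / (2 * ?\<kappa>) * (row_sum k 0 + 2 * ?\<kappa> / 24 + - 2 * ?\<kappa> / 24 * Eisenstein_E2 z)"
  have "residue_eisenstein k N S \<in> quasimodular_forms (Gamma1 N)"
    by (rule mixed_imp_quasimodular[OF modular_form_imp_mixed[OF residue_eisenstein_modular[OF N k(1)]]])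
  then have "?rhs \<in> quasimodular_forms (Gamma1 N)"
    by (intro add mult const Eisenstein_E2_quasimodular)
  then show ?thesis
  proof (rule quasimodular_forms_cong)
    fix z assume "z \<in> upper_half_plane"
    then have z: "Im z > 0" by (simp add: upper_half_plane_def)
    have solve: "x = 1 / (2 * \<kappa>) * (E + - b) + e * c / (2 * \<kappa>) * (t + 2 * \<kappa> / 24 + - 2 * \<kappa> / 24 * E2)"
      if "\<kappa> \<noteq> 0" "E = (b + 2 * \<kappa> * x) - e * c * (t + 2 * \<kappa> * ((1 - E2) / 24))" for x \<kappa> E b e c t E2 :: complex
      unfolding that(2) using that(1) by (simp add: field_simps)
    have "macmahon_G {0} 1 k (nome z) = (1 - Eisenstein_E2 z) / 24" if "k = 2"
      unfolding that by (rule macmahon_G_all_eq)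
    then have "residue_eisenstein k N S z = (of_bool (0 \<in> S) * row_sum k 0 + 2 * ?\<kappa> * macmahon_G S N k (nome z)) -
        of_bool (k = 2) * ?c * (row_sum k 0 + 2 * ?\<kappa> * ((1 - Eisenstein_E2 z) / 24))"
      using residue_eisenstein_eq[OF N S sym k z]
      by (cases "k = 2") (simp_all only: of_bool_eq mult_zero_left)
    from solve[OF lipschitz_const_nonzero this]
    show "macmahon_G S N k (nome z) = ?rhs z" by simp
  qed
qed

lemma macmahon_A_quasimodular:
  assumes N: "N > 0" and S: "S \<subseteq> {0..<int N}" and sym: "symmetric_residues S N"
  shows "(\<lambda>z. macmahon_A S N k (nome z)) \<in> quasimodular_forms (Gamma1 N)"
proof -
  interpret function_algebra "quasimodular_forms (Gamma1 N)"
    by (rule function_algebra_quasimodular_forms) (auto simp: Gamma1_def)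
  have "(\<lambda>z. Lambda_poly k (\<lambda>j. macmahon_G S N j (nome z))) \<in> quasimodular_forms (Gamma1 N)"
    by (intro Lambda_poly_mem macmahon_G_quasimodular N S sym) auto
  then show ?thesis
    by (rule quasimodular_forms_cong)
       (auto intro: macmahon_A_eq_Lambda_poly norm_nome_less_1 simp: upper_half_plane_def)
qed

theorem theorem1p2:
  fixes N k :: nat and S :: "int set"
  assumes "N > 0" and "S \<subseteq> carrier (residue_ring (int N))" and "S \<noteq> {}" and "k > 0"
  shows "(\<forall>q::complex. norm q < 1 \<longrightarrow>
            macmahon_A S N k q = Lambda_poly k (\<lambda>j. macmahon_G S N j q)) \<and>
         (symmetric_residues S N \<longrightarrow>
            (\<lambda>z. macmahon_A S N k (nome z)) \<in> quasimodular_forms (Gamma1 N))"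
proof -
  have "S \<subseteq> {0..<int N}"
    using assms(2) by (auto simp: residue_ring_def)
  then show ?thesis
    using macmahon_A_eq_Lambda_poly macmahon_A_quasimodular[OF assms(1)] by blast
qed

end
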